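(* Let $P$ be a smooth manifold with an almost-Poisson tensor field $\Lambda$, let $H\colon P\to\mathbb{R}$ be a smooth function, and let $Z=\widehat\Lambda\circ \mathrm{d}H$ be its Hamiltonian vector field. Let $\alpha\colon M\to P$ be an embedding with image $P_0=\alpha(M)$. (1) $\alpha$ is a solution of the slicing equation for $(P,Z)$ if and only if $\mathrm{d}H\circ\alpha$ is a section of $\bigl(\widehat\Lambda\bigl((M\times_\alpha TP_0)^\circ\bigr)\bigr)^\circ$. (2) Suppose moreover that $P_0\subset P$ is a Lagrangian submanifold. Then $\alpha$ is a solution of the slicing equation for $(P,Z)$ if and only if $\mathrm{d}H\circ\alpha$ is a section of $(M\times_\alpha TP_0)^\circ+(M\times_\alpha\ker\widehat\Lambda)$, that is to say, if and only if $\alpha^*(\mathrm{d}H)$ is a section of ${}^t(T\alpha)(\ker\widehat\Lambda)$.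
   Context: All manifolds and maps are $C^\infty$. An almost-Poisson tensor field on $P$ is a smooth section $\Lambda$ of $\Lambda^2TP$ (no Jacobi identity and no constancy of rank is assumed). It defines the vector bundle morphism $\widehat\Lambda\colon T^*P\to TP$ by $\langle\beta,\widehat\Lambda(\alpha)\rangle=\Lambda(\alpha,\beta)$ for covectors $\alpha,\beta$ at the same point. Its characteristic distribution is $C=\operatorname{Im}\widehat\Lambda\subset TP$. For a subspace $F$ of a vector space $E$, $F^\circ\subset E^*$ denotes its annihilator (and for a subspace $F\subset E^*$, $F^\circ\subset E$ in the same way, using $E^{**}=E$). A submanifold $P_0\subset P$ is called Lagrangian if at each $z\in P_0$ one has $\widehat\Lambda\bigl((T_zP_0)^\circ\bigr)=T_zP_0\cap C_z$. $M\times_\alpha(\cdot)$ denotes pull-back to $M$ along $\alpha$: the fibre of $M\times_\alpha TP_0$ at $x\in M$ is $T_{\alpha(x)}P_0\subset T_{\alpha(x)}P$, and the fibre of $M\times_\alpha\ker\widehat\Lambda$ at $x$ is $\ker\widehat\Lambda_{\alpha(x)}\subset T^*_{\alpha(x)}P$. Annihilators, images, sums are taken fibrewise, e.g. the fibre of $\bigl(\widehat\Lambda((M\times_\alpha TP_0)^\circ)\bigr)^\circ$ at $x$ is $\bigl(\widehat\Lambda((T_{\alpha(x)}P_0)^\circ)\bigr)^\circ\subset T^*_{\alpha(x)}P$. The map ${}^t(T_x\alpha)\colon T^*_{\alpha(x)}P\to T^*_xM$ is the transpose of $T_x\alpha$. "Is a section of" means that the value at each $x\in M$ lies in the corresponding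 fibre. $\alpha$ is a solution of the slicing equation for $(P,Z)$ if there is a vector field $X$ on $M$ with $T\alpha\circ X=Z\circ\alpha$; for an embedding this is equivalent to $Z$ being tangent to $P_0$. *)

theory Defs
  imports "HOL-Analysis.Analysis"
begin

section \<open>Smooth maps between finite-dimensional spaces\<close>

text \<open>
  Manifolds are modelled on finite-dimensional real inner product spaces. The class
  \<^class>\<open>euclidean_space\<close> is not used because it requires dimension at least one, which would
  exclude zero-dimensional manifolds.
\<close>

class finite_dim_inner = real_inner +
  assumes finite_spanning_set: "\<exists>B. finite B \<and> (\<forall>x. \<exists>r. x = (\<Sum>b\<in>B. r b *\<^sub>R b))"

instance euclidean_space \<subseteq> finite_dim_inner
proof
  have "\<forall>x::'a. \<exists>r. x = (\<Sum>b\<in>Basis. r b *\<^sub>R b)"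
    by (metis euclidean_representation)
  then show "\<exists>B. finite B \<and> (\<forall>x::'a. \<exists>r. x = (\<Sum>b\<in>B. r b *\<^sub>R b))"
    using finite_Basis by blast
qed

text \<open>Used for open \<open>S\<close> only, hence the unrestricted derivatives \<open>at x\<close>.\<close>

primrec Ck_on ::
  "nat \<Rightarrow> 'a::real_normed_vector set \<Rightarrow> ('a \<Rightarrow> 'b::real_normed_vector) \<Rightarrow> bool" where
  "Ck_on 0 S f \<longleftrightarrow> continuous_on S f"
| "Ck_on (Suc k) S f \<longleftrightarrow>
     (\<forall>x\<in>S. f differentiable at x) \<and> (\<forall>v. Ck_on k S (\<lambda>x. frechet_derivative f (at x) v))"

definition smooth_on ::
  "'a::real_normed_vector set \<Rightarrow> ('a \<Rightarrow> 'b::real_normed_vector) \<Rightarrow> bool" where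
  "smooth_on S f \<longleftrightarrow> (\<forall>k. Ck_on k S f)"


section \<open>Smooth manifolds\<close>

text \<open>A chart \<open>(U, \<phi>)\<close>; the values of \<open>\<phi>\<close> outside \<open>U\<close> are irrelevant.\<close>

type_synonym ('p, 'e) chart = "'p set \<times> ('p \<Rightarrow> 'e)"

definition chart_inv :: "('p, 'e) chart \<Rightarrow> 'e \<Rightarrow> 'p" where
  "chart_inv c = inv_into (fst c) (snd c)"

definition chart_image :: "('p, 'e) chart \<Rightarrow> 'e set" where
  "chart_image c = snd c ` fst c"

definition is_chart :: "'p topology \<Rightarrow> ('p, 'e::topological_space) chart \<Rightarrow> bool" where
  "is_chart T c \<longleftrightarrow> openin T (fst c) \<and> open (chart_image c) \<and>
     homeomorphic_map (subtopology T (fst c)) (top_of_set (chart_image c)) (snd c)"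

definition smoothly_compatible ::
  "('p, 'e::real_normed_vector) chart \<Rightarrow> ('p, 'e) chart \<Rightarrow> bool" where
  "smoothly_compatible c d \<longleftrightarrow>
     smooth_on (snd c ` (fst c \<inter> fst d)) (snd d \<circ> chart_inv c) \<and>
     smooth_on (snd d ` (fst c \<inter> fst d)) (snd c \<circ> chart_inv d)"

record ('p, 'e) manifold =
  topo :: "'p topology"
  atlas :: "('p, 'e) chart set"

abbreviation points :: "('p, 'e) manifold \<Rightarrow> 'p set" where
  "points P \<equiv> topspace (topo P)"

text \<open>The atlas need not be maximal; every notion below depends only on the smooth structure
  it generates.\<close>

definition smooth_manifold :: "('p, 'e::finite_dim_inner) manifold \<Rightarrow> bool" where
  "smooth_manifold P \<longleftrightarrow>
     Hausdorff_space (topo P) \<and> second_countable (topo P) \<and>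
     (\<forall>c\<in>atlas P. is_chart (topo P) c) \<and>
     (\<Union>c\<in>atlas P. fst c) = points P \<and>
     (\<forall>c\<in>atlas P. \<forall>d\<in>atlas P. smoothly_compatible c d)"

definition charts_at :: "('p, 'e) manifold \<Rightarrow> 'p \<Rightarrow> ('p, 'e) chart set" where
  "charts_at P p = {c \<in> atlas P. p \<in> fst c}"

definition chart_at :: "('p, 'e) manifold \<Rightarrow> 'p \<Rightarrow> ('p, 'e) chart" where
  "chart_at P p = (SOME c. c \<in> charts_at P p)"

definition smooth_map ::
  "('m, 'd::finite_dim_inner) manifold \<Rightarrow> ('p, 'e::finite_dim_inner) manifold \<Rightarrow> ('m \<Rightarrow> 'p) \<Rightarrow> bool"
  where
  "smooth_map M P f \<longleftrightarrow> continuous_map (topo M) (topo P) f \<and>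
     (\<forall>c\<in>atlas M. \<forall>d\<in>atlas P.
        smooth_on (snd c ` {x \<in> fst c. f x \<in> fst d}) (snd d \<circ> f \<circ> chart_inv c))"

definition smooth_function :: "('p, 'e::finite_dim_inner) manifold \<Rightarrow> ('p \<Rightarrow> real) \<Rightarrow> bool" where
  "smooth_function P H \<longleftrightarrow> (\<forall>c\<in>atlas P. smooth_on (chart_image c) (H \<circ> chart_inv c))"


section \<open>Tangent and cotangent spaces\<close>

text \<open>
  A tangent vector at \<open>p\<close> is a family of vectors of the model space, one for each chart at \<open>p\<close>,
  which transforms by the derivatives of the changes of charts. The components at charts whose
  domain does not contain \<open>p\<close> are fixed to be zero. The vector space operations are pointwise.
\<close>

type_synonym ('p, 'e) tvec = "('p, 'e) chart \<Rightarrow> 'e"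

definition tangent_space :: "('p, 'e::finite_dim_inner) manifold \<Rightarrow> 'p \<Rightarrow> ('p, 'e) tvec set" where
  "tangent_space P p =
     {v. (\<forall>c\<in>charts_at P p. \<forall>d\<in>charts_at P p.
            v d = frechet_derivative (snd d \<circ> chart_inv c) (at (snd c p)) (v c)) \<and>
         (\<forall>c. c \<notin> charts_at P p \<longrightarrow> v c = 0)}"

text \<open>The linear forms on the tangent space, extended by zero outside it, so that addition of
  covectors is pointwise addition of functions.\<close>

type_synonym ('p, 'e) tcovec = "('p, 'e) tvec \<Rightarrow> real"

definition cotangent_space :: "('p, 'e::finite_dim_inner) manifold \<Rightarrow> 'p \<Rightarrow> ('p, 'e) tcovec set"
  where
  "cotangent_space P p =
     {\<beta>. (\<forall>v\<in>tangent_space P p. \<forall>w\<in>tangent_space P p. \<forall>r s.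
            \<beta> (\<lambda>c. r *\<^sub>R v c + s *\<^sub>R w c) = r * \<beta> v + s * \<beta> w) \<and>
         (\<forall>v. v \<notin> tangent_space P p \<longrightarrow> \<beta> v = 0)}"

text \<open>The annihilator of a set of tangent vectors at \<open>p\<close>.\<close>

definition annihilator ::
  "('p, 'e::finite_dim_inner) manifold \<Rightarrow> 'p \<Rightarrow> ('p, 'e) tvec set \<Rightarrow> ('p, 'e) tcovec set" where
  "annihilator P p F = {\<beta> \<in> cotangent_space P p. \<forall>v\<in>F. \<beta> v = 0}"

definition covector_sum ::
  "('p, 'e) tcovec set \<Rightarrow> ('p, 'e) tcovec set \<Rightarrow> ('p, 'e) tcovec set" where
  "covector_sum A B = {\<lambda>v. \<beta> v + \<gamma> v | \<beta> \<gamma>. \<beta> \<in> A \<and> \<gamma> \<in> B}"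

text \<open>In the next two definitions the result does not depend on the chart chosen at \<open>x\<close> or \<open>p\<close>.\<close>

definition tangent_map ::
  "('m, 'd::finite_dim_inner) manifold \<Rightarrow> ('p, 'e::finite_dim_inner) manifold \<Rightarrow> ('m \<Rightarrow> 'p) \<Rightarrow> 'm
     \<Rightarrow> ('m, 'd) tvec \<Rightarrow> ('p, 'e) tvec" where
  "tangent_map M P f x v =
     (\<lambda>d. if d \<in> charts_at P (f x)
          then let c = chart_at M x
               in frechet_derivative (snd d \<circ> f \<circ> chart_inv c) (at (snd c x)) (v c)
          else 0)"

definition differential ::
  "('p, 'e::finite_dim_inner) manifold \<Rightarrow> ('p \<Rightarrow> real) \<Rightarrow> 'p \<Rightarrow> ('p, 'e) tcovec" where
  "differential P H p =
     (\<lambda>v. if v \<in> tangent_space P p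
          then let c = chart_at P p
               in frechet_derivative (H \<circ> chart_inv c) (at (snd c p)) (v c)
          else 0)"

text \<open>The transpose of \<open>tangent_map M P f x\<close>.\<close>

definition cotangent_map ::
  "('m, 'd::finite_dim_inner) manifold \<Rightarrow> ('p, 'e::finite_dim_inner) manifold \<Rightarrow> ('m \<Rightarrow> 'p) \<Rightarrow> 'm
     \<Rightarrow> ('p, 'e) tcovec \<Rightarrow> ('m, 'd) tcovec" where
  "cotangent_map M P f x \<beta> =
     (\<lambda>v. if v \<in> tangent_space M x then \<beta> (tangent_map M P f x v) else 0)"

definition pullback_form ::
  "('m, 'd::finite_dim_inner) manifold \<Rightarrow> ('p, 'e::finite_dim_inner) manifold \<Rightarrow> ('m \<Rightarrow> 'p)
     \<Rightarrow> ('p \<Rightarrow> ('p, 'e) tcovec) \<Rightarrow> 'm \<Rightarrow> ('m, 'd) tcovec" where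
  "pullback_form M P f \<omega> x = cotangent_map M P f x (\<omega> (f x))"

definition smooth_vector_field ::
  "('p, 'e::finite_dim_inner) manifold \<Rightarrow> ('p \<Rightarrow> ('p, 'e) tvec) \<Rightarrow> bool" where
  "smooth_vector_field P X \<longleftrightarrow>
     (\<forall>p\<in>points P. X p \<in> tangent_space P p) \<and>
     (\<forall>c\<in>atlas P. smooth_on (chart_image c) (\<lambda>y. X (chart_inv c y) c))"


section \<open>Embeddings and submanifolds\<close>

definition smooth_embedding ::
  "('m, 'd::finite_dim_inner) manifold \<Rightarrow> ('p, 'e::finite_dim_inner) manifold \<Rightarrow> ('m \<Rightarrow> 'p) \<Rightarrow> bool"
  where
  "smooth_embedding M P f \<longleftrightarrow> smooth_map M P f \<and>
     (\<forall>x\<in>points M. inj_on (tangent_map M P f x) (tangent_space M x)) \<and>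
     embedding_map (topo M) (topo P) f"

definition submanifold ::
  "('p, 'd::finite_dim_inner) manifold \<Rightarrow> ('p, 'e::finite_dim_inner) manifold \<Rightarrow> bool" where
  "submanifold S P \<longleftrightarrow> smooth_manifold S \<and> points S \<subseteq> points P \<and> smooth_embedding S P (\<lambda>z. z)"

text \<open>The tangent space of a submanifold, regarded as a subspace of that of the ambient manifold.\<close>

definition submanifold_tangent_space ::
  "('p, 'd::finite_dim_inner) manifold \<Rightarrow> ('p, 'e::finite_dim_inner) manifold \<Rightarrow> 'p
     \<Rightarrow> ('p, 'e) tvec set" where
  "submanifold_tangent_space S P z = tangent_map S P (\<lambda>z. z) z ` tangent_space S z"

text \<open>The image of an embedding, with the subspace topology and the charts transported from the
  source (so that the embedding becomes a diffeomorphism onto it).\<close>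

definition image_manifold ::
  "('m, 'd) manifold \<Rightarrow> ('p, 'e) manifold \<Rightarrow> ('m \<Rightarrow> 'p) \<Rightarrow> ('p, 'd) manifold" where
  "image_manifold M P f =
     \<lparr> topo = subtopology (topo P) (f ` points M),
       atlas = (\<lambda>c. (f ` fst c, snd c \<circ> inv_into (points M) f)) ` atlas M \<rparr>"


section \<open>Almost-Poisson tensor fields\<close>

text \<open>The value at \<open>p\<close> of a section of the second exterior power of the tangent bundle is given as
  a skew-symmetric bilinear form on the cotangent space at \<open>p\<close>. Smoothness is that of its components
  in each chart; \<open>chart_covector P c a p\<close> is the covector at \<open>p\<close> with constant components \<open>a\<close>.\<close>

type_synonym ('p, 'e) bivector_field = "'p \<Rightarrow> ('p, 'e) tcovec \<Rightarrow> ('p, 'e) tcovec \<Rightarrow> real"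

definition chart_covector ::
  "('p, 'e::finite_dim_inner) manifold \<Rightarrow> ('p, 'e) chart \<Rightarrow> 'e \<Rightarrow> 'p \<Rightarrow> ('p, 'e) tcovec" where
  "chart_covector P c a p = (\<lambda>v. if v \<in> tangent_space P p then a \<bullet> v c else 0)"

definition almost_poisson ::
  "('p, 'e::finite_dim_inner) manifold \<Rightarrow> ('p, 'e) bivector_field \<Rightarrow> bool" where
  "almost_poisson P \<Lambda> \<longleftrightarrow>
     (\<forall>p\<in>points P. \<forall>\<beta>\<in>cotangent_space P p. \<forall>\<gamma>\<in>cotangent_space P p.
        \<Lambda> p \<beta> \<gamma> = - \<Lambda> p \<gamma> \<beta> \<and>
        (\<forall>\<delta>\<in>cotangent_space P p. \<forall>r s.
           \<Lambda> p (\<lambda>v. r * \<beta> v + s * \<gamma> v) \<delta> = r * \<Lambda> p \<beta> \<delta> + s * \<Lambda> p \<gamma> \<delta>)) \<and>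
     (\<forall>c\<in>atlas P. \<forall>a b. smooth_on (chart_image c)
        (\<lambda>y. \<Lambda> (chart_inv c y) (chart_covector P c a (chart_inv c y))
                                 (chart_covector P c b (chart_inv c y))))"

definition sharp ::
  "('p, 'e::finite_dim_inner) manifold \<Rightarrow> ('p, 'e) bivector_field \<Rightarrow> 'p
     \<Rightarrow> ('p, 'e) tcovec \<Rightarrow> ('p, 'e) tvec" where
  "sharp P \<Lambda> p \<alpha> =
     (THE v. v \<in> tangent_space P p \<and> (\<forall>\<beta>\<in>cotangent_space P p. \<beta> v = \<Lambda> p \<alpha> \<beta>))"

definition sharp_kernel ::
  "('p, 'e::finite_dim_inner) manifold \<Rightarrow> ('p, 'e) bivector_field \<Rightarrow> 'p \<Rightarrow> ('p, 'e) tcovec set" where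
  "sharp_kernel P \<Lambda> p = {\<beta> \<in> cotangent_space P p. sharp P \<Lambda> p \<beta> = (\<lambda>_. 0)}"

definition characteristic_distribution ::
  "('p, 'e::finite_dim_inner) manifold \<Rightarrow> ('p, 'e) bivector_field \<Rightarrow> 'p \<Rightarrow> ('p, 'e) tvec set" where
  "characteristic_distribution P \<Lambda> p = sharp P \<Lambda> p ` cotangent_space P p"

definition hamiltonian_field ::
  "('p, 'e::finite_dim_inner) manifold \<Rightarrow> ('p, 'e) bivector_field \<Rightarrow> ('p \<Rightarrow> real)
     \<Rightarrow> 'p \<Rightarrow> ('p, 'e) tvec" where
  "hamiltonian_field P \<Lambda> H p = sharp P \<Lambda> p (differential P H p)"

definition lagrangian_submanifold ::
  "('p, 'd::finite_dim_inner) manifold \<Rightarrow> ('p, 'e::finite_dim_inner) manifold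
     \<Rightarrow> ('p, 'e) bivector_field \<Rightarrow> bool" where
  "lagrangian_submanifold S P \<Lambda> \<longleftrightarrow> submanifold S P \<and>
     (\<forall>z\<in>points S.
        sharp P \<Lambda> z ` annihilator P z (submanifold_tangent_space S P z) =
        submanifold_tangent_space S P z \<inter> characteristic_distribution P \<Lambda> z)"

definition slicing_solution ::
  "('m, 'd::finite_dim_inner) manifold \<Rightarrow> ('p, 'e::finite_dim_inner) manifold
     \<Rightarrow> ('p \<Rightarrow> ('p, 'e) tvec) \<Rightarrow> ('m \<Rightarrow> 'p) \<Rightarrow> bool" where
  "slicing_solution M P Z f \<longleftrightarrow>
     (\<exists>X. smooth_vector_field M X \<and> (\<forall>x\<in>points M. tangent_map M P f x (X x) = Z (f x)))"

end

theory Submission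
  imports Defs
begin

text \<open>
  Pointwise everything is linear algebra in the finite-dimensional spaces \<open>T\<^sub>zP\<close>, with \<open>T\<close> the tangent
  space of \<open>P\<^sub>0\<close> at \<open>z\<close>. By skew-symmetry, \<open>dH\<close> annihilates the image of \<open>T\<^sup>\<circ>\<close> under the sharp map
  iff \<open>T\<^sup>\<circ>\<close> annihilates \<open>Z = sharp dH\<close>, iff \<open>Z \<in> T\<^sup>\<circ>\<^sup>\<circ> = T\<close>. As \<open>Z\<close> always lies in the characteristic
  distribution \<open>C\<close>, in the Lagrangian case \<open>Z \<in> T\<close> iff \<open>Z \<in> T \<inter> C = sharp T\<^sup>\<circ>\<close>, iff \<open>dH\<close> differs
  from an element of \<open>T\<^sup>\<circ>\<close> by one of the kernel; applying the transpose of \<open>T\<alpha>\<close>, whose kernel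
  is \<open>T\<^sup>\<circ>\<close>, gives the last form.

  The analytic point is that a pointwise lift \<open>X\<close> of \<open>Z \<circ> \<alpha>\<close> is automatically smooth: in charts
  it solves a linear system with smooth injective coefficient matrix and smooth right-hand side.
\<close>

section \<open>Orthonormal expansions\<close>

text \<open>The model spaces carry no distinguished basis and may be trivial, so coordinates are
  taken over a fixed finite set \<open>onb\<close>. Two obstacles shape the proof. Smoothness is
  tested direction by direction, with a fixed direction, so a derivative applied to a vector that
  moves with the point has to be expanded over \<open>onb\<close> first. Tangent vectors are
  families over all charts, whereas tangent maps and differentials are defined in one chosen chart;
  independence of that choice is settled by a single chain rule, after which identities between
  vectors are checked in one chart. Finite dimension enters
  \<open>T\<^sup>\<circ>\<^sup>\<circ> = T\<close> through an orthogonal projection. The lift of the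
  Hamiltonian field requires no straightening of the embedding: pointwise injectivity already
  provides the left inverse that controls it.\<close>

lemma finite_orthonormal_span:
  fixes A :: "'a::real_inner set"
  assumes "finite A"
  obtains B where "finite B" "\<And>b b'. b \<in> B \<Longrightarrow> b' \<in> B \<Longrightarrow> b \<bullet> b' = (if b = b' then 1 else 0)"
    "span B = span A"
proof -
  have "\<exists>B. finite B \<and> (\<forall>b\<in>B. \<forall>b'\<in>B. b \<bullet> b' = (if b = b' then 1 else 0)) \<and> span B = span A"
    using assms
  proof induction
    case empty
    then show ?case by blast
  next
    case (insert a A)
    then obtain B where B: "finite B" "\<And>b b'. b \<in> B \<Longrightarrow> b' \<in> B \<Longrightarrow> b \<bullet> b' = (if b = b' then 1 else 0)"
      "span B = span A"
      by blast
    \<comment> \<open>Gram-Schmidt: \<open>p\<close> is the projection of \<open>a\<close> on the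
      span reached so far. If \<open>a = p\<close> the old set serves, otherwise the normalised
      residue is added.\<close>
    define p where "p = (\<Sum>b\<in>B. (a \<bullet> b) *\<^sub>R b)"
    have p_span: "p \<in> span A"
      unfolding p_def B(3)[symmetric] by (intro span_sum span_scale span_base)
    have orth: "(a - p) \<bullet> b = 0" if "b \<in> B" for b
    proof -
      have "p \<bullet> b = (\<Sum>c\<in>B. (if c = b then a \<bullet> c else 0))"
        unfolding p_def inner_sum_left by (intro sum.cong refl) (simp add: B(2) that)
      also have "\<dots> = a \<bullet> b"
        using B(1) that by simp
      finally show ?thesis by (simp add: inner_diff_left)
    qed
    show ?case
    proof (cases "a = p")
      case True
      then have "span (insert a A) = span A"
        using span_redundant[OF p_span] by simp
      with B show ?thesis
        by (intro exI[of _ B]) simp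
    next
      case False
      define e where "e = (1 / norm (a - p)) *\<^sub>R (a - p)"
      have nz: "norm (a - p) \<noteq> 0"
        using False by simp
      have e1: "e \<bullet> e = 1"
        using nz unfolding e_def
        by (simp add: dot_square_norm power2_eq_square)
      have e0: "e \<bullet> b = 0" "b \<bullet> e = 0" if "b \<in> B" for b
        using orth[OF that] by (simp_all add: e_def inner_commute)
      have e_not: "e \<notin> B"
        using e0(1) e1 by force
      have "span (insert e B) = span (insert a A)"
      proof (rule span_eq[THEN iffD2], intro conjI insert_subsetI subsetI)
        have "p \<in> span (insert a A)"
          using p_span span_mono[of A "insert a A"] by blast
        then show "e \<in> span (insert a A)"
          unfolding e_def by (intro span_scale span_diff) (auto intro: span_base)
        show "x \<in> span (insert a A)" if "x \<in> B" for x
          using that B(3) span_base[of x B] span_mono[of A "insert a A"] by blast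
        have A: "span A \<subseteq> span (insert e B)"
          using B(3) span_mono[of B "insert e B"] by blast
        have "a = norm (a - p) *\<^sub>R e + p"
          using nz by (simp add: e_def)
        moreover have "norm (a - p) *\<^sub>R e + p \<in> span (insert e B)"
          using p_span A by (intro span_add span_scale) (auto intro: span_base)
        ultimately show "a \<in> span (insert e B)"
          by simp
        show "x \<in> span (insert e B)" if "x \<in> A" for x
          using that A span_base[of x A] by blast
      qed
      moreover have "\<forall>b\<in>insert e B. \<forall>b'\<in>insert e B. b \<bullet> b' = (if b = b' then 1 else 0)"
        using B(2) e1 e0 by (auto simp: e_not)
      ultimately show ?thesis
        using B(1) by (intro exI[of _ "insert e B"]) simp
    qed
  qed
  then show ?thesis
    using that by blast
qed

text \<open>Both sides are linear in \<open>x\<close>, and for \<open>x\<close> in \<open>B\<close>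
  orthonormality leaves a single term of the sum.\<close>

lemma orthonormal_span_expansion:
  fixes B :: "'a::real_inner set"
  assumes "finite B" and orth: "\<And>b b'. b \<in> B \<Longrightarrow> b' \<in> B \<Longrightarrow> b \<bullet> b' = (if b = b' then 1 else 0)"
    and "x \<in> span B"
  shows "(\<Sum>b\<in>B. (x \<bullet> b) *\<^sub>R b) = x"
  using assms(3)
proof (induction rule: span_induct_alt)
  case base
  then show ?case by simp
next
  case (step c a y)
  have "(\<Sum>b\<in>B. (a \<bullet> b) *\<^sub>R b) = (\<Sum>b\<in>B. (if a = b then b else 0))"
    by (intro sum.cong refl) (simp add: orth step.hyps(1))
  also have "\<dots> = a"
    using assms(1) step.hyps(1) by simp
  finally have "(\<Sum>b\<in>B. (a \<bullet> b) *\<^sub>R b) = a" .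
  moreover have "(\<Sum>b\<in>B. ((c *\<^sub>R a + y) \<bullet> b) *\<^sub>R b)
      = c *\<^sub>R (\<Sum>b\<in>B. (a \<bullet> b) *\<^sub>R b) + (\<Sum>b\<in>B. (y \<bullet> b) *\<^sub>R b)"
    by (simp add: inner_add_left scaleR_add_left sum.distrib scaleR_sum_right)
  ultimately show ?case
    using step.IH by simp
qed

text \<open>Encoded by the expansion alone, the form in which coordinates enter below. In a trivial
  space the empty set qualifies.\<close>

definition onb :: "'a::finite_dim_inner set" where
  "onb = (SOME B. finite B \<and> (\<forall>x. (\<Sum>b\<in>B. (x \<bullet> b) *\<^sub>R b) = x))"

lemma onb: "finite (onb :: 'a::finite_dim_inner set)"
  and onb_expansion: "(\<Sum>b\<in>onb. (x \<bullet> b) *\<^sub>R b) = (x :: 'a::finite_dim_inner)"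
proof -
  obtain A :: "'a set" where A: "finite A" "\<And>x. \<exists>r. x = (\<Sum>b\<in>A. r b *\<^sub>R b)"
    using finite_spanning_set by blast
  have "x \<in> span A" for x
    using A(2)[of x] by (auto intro!: span_sum span_scale intro: span_base)
  moreover obtain B where B: "finite B" "\<And>b b'. b \<in> B \<Longrightarrow> b' \<in> B \<Longrightarrow> b \<bullet> b' = (if b = b' then 1 else 0)"
    "span B = span A"
    by (rule finite_orthonormal_span[OF A(1)]) blast
  ultimately have "(\<Sum>b\<in>B. (x \<bullet> b) *\<^sub>R b) = x" for x
    by (intro orthonormal_span_expansion[OF B(1,2)]) simp_all
  with B(1) have "\<exists>B::'a set. finite B \<and> (\<forall>x. (\<Sum>b\<in>B. (x \<bullet> b) *\<^sub>R b) = x)"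
    by blast
  from someI_ex[OF this] show "finite (onb :: 'a set)" "(\<Sum>b\<in>onb. (x \<bullet> b) *\<^sub>R b) = x"
    unfolding onb_def by blast+
qed

text \<open>The coefficients depend on the argument only and the vectors on the map only. This is
  what turns \<open>A x (v x)\<close> into a finite sum of products.\<close>

lemma linear_onb_expansion:
  fixes f :: "'a::finite_dim_inner \<Rightarrow> 'b::real_vector"
  assumes "linear f"
  shows "f x = (\<Sum>b\<in>onb. (x \<bullet> b) *\<^sub>R f b)"
  by (subst onb_expansion[of x, symmetric]) (simp add: linear_sum[OF assms] linear_scale[OF assms])

lemma linear_imp_bounded_linear_finite_dim:
  fixes f :: "'a::finite_dim_inner \<Rightarrow> 'b::real_normed_vector"
  assumes "linear f"
  shows "bounded_linear f"
proof -
  have "bounded_linear (\<lambda>x. \<Sum>b\<in>onb. (x \<bullet> b) *\<^sub>R f b)"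
    by (intro bounded_linear_sum bounded_linear_compose[OF bounded_linear_scaleR_left]
        bounded_linear_inner_left)
  then show ?thesis
    by (simp only: linear_onb_expansion[OF assms, symmetric])
qed

text \<open>The separation argument behind \<open>T\<^sup>\<circ>\<^sup>\<circ> = T\<close>. The
  range is spanned by the finitely many images of \<open>onb\<close>, so \<open>z\<close> can be
  projected on it orthogonally, and \<open>a\<close> is the residue.\<close>

lemma separate_from_range:
  fixes L :: "'a::finite_dim_inner \<Rightarrow> 'b::real_inner"
  assumes "linear L" "z \<notin> range L"
  obtains a where "\<And>u. a \<bullet> L u = 0" "a \<bullet> z \<noteq> 0"
proof -
  obtain B where B: "finite B" "\<And>b b'. b \<in> B \<Longrightarrow> b' \<in> B \<Longrightarrow> b \<bullet> b' = (if b = b' then 1 else 0)"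
    "span B = span (L ` onb)"
    by (rule finite_orthonormal_span[OF finite_imageI[OF onb]]) blast
  have range: "L u \<in> span B" for u
    unfolding B(3) linear_onb_expansion[OF assms(1), of u]
    by (intro span_sum span_scale span_base imageI)
  define p where "p = (\<Sum>b\<in>B. (z \<bullet> b) *\<^sub>R b)"
  have "span B \<subseteq> range L"
    unfolding B(3) by (intro span_minimal linear_subspace_image[OF assms(1)]) auto
  moreover have p: "p \<in> span B"
    unfolding p_def by (intro span_sum span_scale span_base)
  ultimately have "z \<noteq> p"
    using assms(2) by blast
  have orth: "(z - p) \<bullet> s = 0" if "s \<in> span B" for s
    using that
  proof (induction rule: span_induct_alt)
    case base
    then show ?case by simp
  next
    case (step c b y)
    have "p \<bullet> b = (\<Sum>d\<in>B. (if d = b then z \<bullet> d else 0))"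
      unfolding p_def inner_sum_left by (intro sum.cong refl) (simp add: B(2) step)
    then have "p \<bullet> b = z \<bullet> b"
      using B(1) step.hyps(1) by simp
    then show ?case
      using step.IH by (simp add: inner_add_right inner_diff_left)
  qed
  \<comment> \<open>The residue is orthogonal to \<open>p\<close>, so pairing it with
    \<open>z\<close> yields its squared norm.\<close>
  have "(z - p) \<bullet> z = (z - p) \<bullet> (z - p)"
    using orth[OF p] by (simp add: inner_diff_right)
  then show ?thesis
    using that[of "z - p"] orth[OF range] \<open>z \<noteq> p\<close> by simp
qed


section \<open>Calculus of \<open>C\<^sup>k\<close> maps\<close>

text \<open>The recursion descends to order zero, where differentiability gives continuity.
  \<open>f\<close> is generalised because the induction hypothesis is applied to its directional
  derivatives.\<close>

lemma Ck_on_Suc_imp: "Ck_on (Suc k) S f \<Longrightarrow> Ck_on k S f"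
proof (induction k arbitrary: f)
  case 0
  then show ?case
    by (auto intro!: continuous_at_imp_continuous_on differentiable_imp_continuous_within)
next
  case (Suc k)
  from Suc.prems have "\<forall>v. Ck_on (Suc k) S (\<lambda>x. frechet_derivative f (at x) v)"
    and d: "\<forall>x\<in>S. f differentiable at x"
    by simp_all
  then have "\<forall>v. Ck_on k S (\<lambda>x. frechet_derivative f (at x) v)"
    using Suc.IH by blast
  with d show ?case by simp
qed

lemma Ck_on_imp_continuous_on: "Ck_on k S f \<Longrightarrow> continuous_on S f"
proof (induction k)
  case (Suc k)
  then show ?case using Ck_on_Suc_imp by blast
qed simp

text \<open>A derivative depends only on the germ. Coordinate expressions of the same map agree only
  on open chart domains, so this is how one replaces another.\<close>

lemma frechet_derivative_transform_open:
  assumes "f differentiable at x" "open S" "x \<in> S" "\<And>y. y \<in> S \<Longrightarrow> f y = g y"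
  shows "g differentiable at x" "frechet_derivative g (at x) = frechet_derivative f (at x)"
proof -
  have "(g has_derivative frechet_derivative f (at x)) (at x)"
    using assms(1) unfolding frechet_derivative_works
    by (rule has_derivative_transform_within_open[OF _ assms(2-4)])
  then show "g differentiable at x" "frechet_derivative g (at x) = frechet_derivative f (at x)"
    by (auto simp: differentiable_def frechet_derivative_at[symmetric])
qed

lemma Ck_on_cong:
  assumes "Ck_on k S f" "open S" "\<And>x. x \<in> S \<Longrightarrow> f x = g x"
  shows "Ck_on k S g"
  using assms
proof (induction k arbitrary: f g)
  case 0
  then show ?case using continuous_on_cong[of S S f g] by simp
next
  case (Suc k)
  have d: "g differentiable at x" "frechet_derivative f (at x) = frechet_derivative g (at x)"
    if "x \<in> S" for x
    using frechet_derivative_transform_open[of f x S g] Suc.prems that by auto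
  have "Ck_on k S (\<lambda>x. frechet_derivative f (at x) v)" for v
    using Suc.prems(1) by simp
  then have "Ck_on k S (\<lambda>x. frechet_derivative g (at x) v)" for v
    by (rule Suc.IH[OF _ Suc.prems(2)]) (simp add: d)
  then show ?case
    using d by simp
qed

text \<open>Differentiability and directional derivatives are pointwise notions. The lift of a
  vector field uses this to change the target chart from point to point.\<close>

lemma Ck_on_local:
  assumes "\<And>x. x \<in> S \<Longrightarrow> \<exists>U. open U \<and> x \<in> U \<and> Ck_on k U f"
  shows "Ck_on k S f"
  using assms
proof (induction k arbitrary: f)
  case 0
  show ?case
    unfolding Ck_on.simps
  proof (rule continuous_at_imp_continuous_on, rule ballI)
    fix x assume "x \<in> S"
    then obtain U where "open U" "x \<in> U" "continuous_on U f"
      using 0 by auto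
    then show "isCont f x"
      by (simp add: continuous_on_eq_continuous_at)
  qed
next
  case (Suc k)
  have "f differentiable at x" if "x \<in> S" for x
    using Suc.prems[OF that] by auto
  moreover have "Ck_on k S (\<lambda>x. frechet_derivative f (at x) v)" for v
  proof (rule Suc.IH)
    show "\<exists>U. open U \<and> x \<in> U \<and> Ck_on k U (\<lambda>x. frechet_derivative f (at x) v)" if "x \<in> S" for x
      using Suc.prems[OF that] by auto
  qed
  ultimately show ?case by simp
qed

text \<open>With the derivative given as an explicit formula \<open>D\<close>, each closure property
  below becomes an induction on \<open>k\<close> whose step is one differentiation rule.\<close>

lemma Ck_on_SucI:
  assumes "open S" "\<And>x. x \<in> S \<Longrightarrow> (f has_derivative D x) (at x)" "\<And>v. Ck_on k S (\<lambda>x. D x v)"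
  shows "Ck_on (Suc k) S f"
proof -
  have "frechet_derivative f (at x) = D x" if "x \<in> S" for x
    using assms(2)[OF that] by (simp add: frechet_derivative_at[symmetric])
  then have "Ck_on k S (\<lambda>x. frechet_derivative f (at x) v)" for v
    by (intro Ck_on_cong[OF assms(3)[of v] assms(1)]) simp
  then show ?thesis
    using assms(2) by (auto simp: differentiable_def)
qed

lemma Ck_on_has_derivative:
  assumes "Ck_on (Suc k) S f" "x \<in> S"
  shows "(f has_derivative frechet_derivative f (at x)) (at x)"
  using assms by (simp add: frechet_derivative_works[symmetric])

lemma Ck_on_const: "open S \<Longrightarrow> Ck_on k S (\<lambda>_. c)"
proof (induction k arbitrary: c)
  case (Suc k)
  show ?case
    by (rule Ck_on_SucI[OF Suc.prems has_derivative_const]) (rule Suc.IH[OF Suc.prems])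
qed simp

lemma Ck_on_linear:
  assumes "bounded_linear L" "open S" "Ck_on k S f"
  shows "Ck_on k S (\<lambda>x. L (f x))"
  using assms(3)
proof (induction k arbitrary: f)
  case 0
  then show ?case
    using bounded_linear.continuous_on[OF assms(1)] by simp
next
  case (Suc k)
  show ?case
  proof (rule Ck_on_SucI[OF assms(2)])
    show "((\<lambda>x. L (f x)) has_derivative (\<lambda>v. L (frechet_derivative f (at x) v))) (at x)"
      if "x \<in> S" for x
      by (rule bounded_linear.has_derivative[OF assms(1) Ck_on_has_derivative[OF Suc.prems that]])
    show "Ck_on k S (\<lambda>x. L (frechet_derivative f (at x) v))" for v
      using Suc.prems by (intro Suc.IH) simp
  qed
qed

lemma Ck_on_add:
  assumes "open S" "Ck_on k S f" "Ck_on k S g"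
  shows "Ck_on k S (\<lambda>x. f x + g x)"
  using assms(2,3)
proof (induction k arbitrary: f g)
  case 0
  then show ?case by (simp add: continuous_on_add)
next
  case (Suc k)
  show ?case
  proof (rule Ck_on_SucI[OF assms(1)])
    show "((\<lambda>x. f x + g x) has_derivative
        (\<lambda>v. frechet_derivative f (at x) v + frechet_derivative g (at x) v)) (at x)"
      if "x \<in> S" for x
      using Suc.prems[THEN Ck_on_has_derivative, OF that] by (rule has_derivative_add)
    show "Ck_on k S (\<lambda>x. frechet_derivative f (at x) v + frechet_derivative g (at x) v)" for v
      using Suc.prems by (intro Suc.IH) simp_all
  qed
qed

lemma Ck_on_scaleR:
  assumes "open S" "Ck_on k S f" "Ck_on k S g"
  shows "Ck_on k S (\<lambda>x. f x *\<^sub>R g x)"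
  using assms(2,3)
proof (induction k arbitrary: f g)
  case 0
  then show ?case by (simp add: continuous_on_scaleR)
next
  case (Suc k)
  show ?case
  proof (rule Ck_on_SucI[OF assms(1)])
    show "((\<lambda>x. f x *\<^sub>R g x) has_derivative
        (\<lambda>v. f x *\<^sub>R frechet_derivative g (at x) v + frechet_derivative f (at x) v *\<^sub>R g x)) (at x)"
      if "x \<in> S" for x
      using Suc.prems[THEN Ck_on_has_derivative, OF that] by (rule has_derivative_scaleR)
    \<comment> \<open>The product rule mixes derivatives with undifferentiated factors, whose order
      is lowered to \<open>k\<close> before the induction hypothesis applies.\<close>
    show "Ck_on k S (\<lambda>x. f x *\<^sub>R frechet_derivative g (at x) v
        + frechet_derivative f (at x) v *\<^sub>R g x)" for v
      using Suc.prems Suc.prems[THEN Ck_on_Suc_imp]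
      by (intro Ck_on_add[OF assms(1)] Suc.IH) simp_all
  qed
qed

lemma Ck_on_sum:
  assumes "open S" "\<And>i. i \<in> I \<Longrightarrow> Ck_on k S (f i)"
  shows "Ck_on k S (\<lambda>x. \<Sum>i\<in>I. f i x)"
  using assms(2)
  by (induction I rule: infinite_finite_induct) (auto intro: Ck_on_const Ck_on_add assms(1))

lemma Ck_on_componentwise:
  fixes f :: "_ \<Rightarrow> 'b::finite_dim_inner"
  assumes "open S" "\<And>b. b \<in> onb \<Longrightarrow> Ck_on k S (\<lambda>x. f x \<bullet> b)"
  shows "Ck_on k S f"
proof -
  have "Ck_on k S (\<lambda>x. \<Sum>b\<in>onb. (f x \<bullet> b) *\<^sub>R b)"
    by (intro Ck_on_sum Ck_on_scaleR Ck_on_const assms)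
  then show ?thesis
    by (simp add: onb_expansion)
qed

text \<open>\<open>A\<close> is known to be regular for fixed arguments only, while chain rules
  evaluate it on a moving vector. Expanding \<open>v x\<close> over \<open>onb\<close> leaves scalar
  coordinates times the functions \<open>A x b\<close>.\<close>

lemma Ck_on_linear_family:
  fixes v :: "_ \<Rightarrow> 'b::finite_dim_inner"
  assumes "open S" "\<And>u. Ck_on k S (\<lambda>x. A x u)" "\<And>x. x \<in> S \<Longrightarrow> linear (A x)" "Ck_on k S v"
  shows "Ck_on k S (\<lambda>x. A x (v x))"
proof (rule Ck_on_cong[OF _ assms(1)])
  show "Ck_on k S (\<lambda>x. \<Sum>b\<in>onb. (v x \<bullet> b) *\<^sub>R A x b)"
    by (intro Ck_on_sum Ck_on_scaleR Ck_on_linear[OF bounded_linear_inner_left] assms)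
  show "(\<Sum>b\<in>onb. (v x \<bullet> b) *\<^sub>R A x b) = A x (v x)" if "x \<in> S" for x
    using linear_onb_expansion[OF assms(3)[OF that], of "v x"] by simp
qed

text \<open>The derivative is that of \<open>g\<close> along \<open>f\<close>, applied to a moving
  vector. Only \<open>g\<close> is generalised: the induction hypothesis concerns directional
  derivatives of \<open>g\<close> with the same inner map.\<close>

lemma Ck_on_compose:
  fixes g :: "'b::finite_dim_inner \<Rightarrow> 'c::real_normed_vector"
  assumes "open S" "Ck_on k S f" "Ck_on k T g" "f ` S \<subseteq> T"
  shows "Ck_on k S (\<lambda>x. g (f x))"
  using assms(2,3)
proof (induction k arbitrary: g)
  case 0
  then show ?case
    using assms(4) continuous_on_compose2[of T g S f] by simp
next
  case (Suc k)
  have dg: "(g has_derivative frechet_derivative g (at (f x))) (at (f x))" if "x \<in> S" for x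
    using Ck_on_has_derivative[OF Suc.prems(2)] that assms(4) by blast
  have df: "(f has_derivative frechet_derivative f (at x)) (at x)" if "x \<in> S" for x
    using Ck_on_has_derivative[OF Suc.prems(1) that] .
  show ?case
  proof (rule Ck_on_SucI[OF assms(1)])
    show "((\<lambda>x. g (f x)) has_derivative
        (\<lambda>v. frechet_derivative g (at (f x)) (frechet_derivative f (at x) v))) (at x)"
      if "x \<in> S" for x
      using has_derivative_compose[OF df dg] that by blast
    show "Ck_on k S (\<lambda>x. frechet_derivative g (at (f x)) (frechet_derivative f (at x) v))" for v
    proof (rule Ck_on_linear_family[OF assms(1)])
      show "Ck_on k S (\<lambda>x. frechet_derivative g (at (f x)) u)" for u
        using Suc.prems Ck_on_Suc_imp[OF Suc.prems(1)] by (intro Suc.IH) auto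
      show "linear (frechet_derivative g (at (f x)))" if "x \<in> S" for x
        using dg[OF that] by (rule has_derivative_linear)
      show "Ck_on k S (\<lambda>x. frechet_derivative f (at x) v)"
        using Suc.prems(1) by simp
    qed
  qed
qed

section \<open>Linear systems with \<open>C^k\<close> coefficients\<close>

lemma has_derivative_product_of_null:
  fixes p :: "'a::real_normed_vector \<Rightarrow> real" and q :: "'a \<Rightarrow> 'b::real_normed_vector"
  assumes p: "(p \<longlongrightarrow> 0) (at x)" "p x = 0" and q: "(q has_derivative q') (at x)" "q x = 0"
  shows "((\<lambda>y. p y *\<^sub>R q y) has_derivative (\<lambda>_. 0)) (at x)"
proof -
  interpret q': bounded_linear q'
    using q(1) by (rule has_derivative_bounded_linear)
  obtain K where K: "norm (q' h) \<le> norm h * K" for h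
    using q'.bounded by blast
  have lim: "((\<lambda>y. norm (q y - q' (y - x)) / norm (y - x)) \<longlongrightarrow> 0) (at x)"
    using q unfolding has_derivative_iff_norm by simp
  \<comment> \<open>A differentiable \<open>q\<close> with \<open>q x = 0\<close> is bounded near
    \<open>x\<close> by a multiple of the distance to \<open>x\<close>, and \<open>p\<close>
    supplies a factor tending to zero. Thus continuity of \<open>p\<close> at \<open>x\<close> is
    enough.\<close>
  have "((\<lambda>y. \<bar>p y\<bar> * (norm (q y - q' (y - x)) / norm (y - x) + K)) \<longlongrightarrow> 0 * (0 + K)) (at x)"
    by (intro tendsto_mult tendsto_add lim tendsto_const tendsto_rabs_zero p)
  then have lim0: "((\<lambda>y. \<bar>p y\<bar> * (norm (q y - q' (y - x)) / norm (y - x) + K)) \<longlongrightarrow> 0) (at x)"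
    by simp
  have "((\<lambda>y. norm (p y *\<^sub>R q y) / norm (y - x)) \<longlongrightarrow> 0) (at x)"
  proof (rule Lim_null_comparison[OF _ lim0], unfold eventually_at_filter, intro always_eventually allI impI)
    fix y assume "y \<noteq> x"
    have "norm (q y) \<le> norm (q y - q' (y - x)) + norm (q' (y - x))"
      using norm_triangle_ineq[of "q y - q' (y - x)" "q' (y - x)"] by simp
    also have "\<dots> \<le> norm (q y - q' (y - x)) + norm (y - x) * K"
      using K by simp
    finally have "norm (q y) / norm (y - x) \<le> norm (q y - q' (y - x)) / norm (y - x) + K"
      using \<open>y \<noteq> x\<close> by (simp add: field_simps)
    then have "\<bar>p y\<bar> * (norm (q y) / norm (y - x)) \<le> \<bar>p y\<bar> * (norm (q y - q' (y - x)) / norm (y - x) + K)"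
      by (intro mult_left_mono) simp_all
    then show "norm (norm (p y *\<^sub>R q y) / norm (y - x))
        \<le> \<bar>p y\<bar> * (norm (q y - q' (y - x)) / norm (y - x) + K)"
      by simp
  qed
  then show ?thesis
    unfolding has_derivative_iff_norm using p q by (simp add: bounded_linear_zero)
qed

text \<open>If \<open>L\<close> is a left inverse of \<open>A x\<close>, then \<open>v = L w - L (A - A x) v\<close>; this gives first the
  continuity of the solution \<open>v\<close> at \<open>x\<close> and then its differentiability.\<close>

lemma linear_system_solution_continuous:
  fixes A :: "'a::real_normed_vector \<Rightarrow> 'd::finite_dim_inner \<Rightarrow> 'e::finite_dim_inner"
  assumes S: "open S" "x \<in> S"
    and A: "\<And>y. y \<in> S \<Longrightarrow> linear (A y)" "inj (A x)" "\<And>u. continuous_on S (\<lambda>y. A y u)"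
    and w: "continuous_on S w" "\<And>y. y \<in> S \<Longrightarrow> A y (v y) = w y"
  shows "isCont v x"
proof -
  obtain L where L: "linear L" "L \<circ> A x = id"
    using linear_injective_left_inverse[OF A(1)[OF S(2)] A(2)] by blast
  have LA: "L (A x u) = u" for u
    using L(2) by (metis comp_apply id_apply)
  have L_bl: "bounded_linear L"
    using L(1) by (rule linear_imp_bounded_linear_finite_dim)
  then obtain K where K: "K > 0" "\<And>z. norm (L z) \<le> norm z * K"
    using bounded_linear.pos_bounded by blast
  have contA: "((\<lambda>y. A y u) \<longlongrightarrow> A x u) (at x)" for u
    using A(3)[of u] S by (metis continuous_on_eq_continuous_at isCont_def)
  have contw: "(w \<longlongrightarrow> w x) (at x)"
    using w(1) S by (metis continuous_on_eq_continuous_at isCont_def)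
  \<comment> \<open>Dominates the operator norm of \<open>L \<circ> (A y - A x)\<close>: by
    Cauchy-Schwarz the coordinate \<open>u \<bullet> b\<close> is at most
    \<open>norm u * norm b\<close>.\<close>
  define \<epsilon> where "\<epsilon> y = (\<Sum>b\<in>onb. norm b * norm (L (A y b - A x b)))" for y
  have "((\<lambda>y. \<epsilon> y) \<longlongrightarrow> (\<Sum>b\<in>(onb::'d set). norm b * norm (L (A x b - A x b)))) (at x)"
    unfolding \<epsilon>_def
    by (intro tendsto_sum tendsto_mult tendsto_norm bounded_linear.tendsto[OF L_bl] tendsto_diff contA tendsto_const)
  then have "(\<epsilon> \<longlongrightarrow> 0) (at x)"
    by (simp add: linear_0[OF L(1)])
  \<comment> \<open>A perturbation of the identity of size below 1/2 leaves at least half of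
    \<open>norm u\<close>; hence the factor 2 in the bound \<open>2 * K\<close>.\<close>
  then have ev: "\<forall>\<^sub>F y in at x. \<epsilon> y < 1/2"
    by (rule order_tendstoD) simp
  have evS: "\<forall>\<^sub>F y in at x. y \<in> S"
    using S by (rule eventually_at_in_open')
  have lower: "norm u \<le> 2 * K * norm (A y u)" if "y \<in> S" "\<epsilon> y < 1/2" for y u
  proof -
    have "L (A y u) - u = L (A y u - A x u)"
      by (simp add: linear_diff[OF L(1)] LA)
    also have "\<dots> = (\<Sum>b\<in>onb. (u \<bullet> b) *\<^sub>R L (A y b - A x b))"
      by (subst linear_onb_expansion[OF A(1)[OF that(1)]], subst linear_onb_expansion[OF A(1)[OF S(2)]])
        (simp add: linear_diff[OF L(1)] linear_sum[OF L(1)] linear_scale[OF L(1)]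
          scaleR_diff_right sum_subtractf)
    also have "norm \<dots> \<le> (\<Sum>b\<in>onb. norm u * (norm b * norm (L (A y b - A x b))))"
    proof (rule sum_norm_le)
      fix b :: 'd
      show "norm ((u \<bullet> b) *\<^sub>R L (A y b - A x b)) \<le> norm u * (norm b * norm (L (A y b - A x b)))"
        using mult_right_mono[OF Cauchy_Schwarz_ineq2[of u b] norm_ge_zero] by (simp add: mult.assoc)
    qed
    also have "\<dots> = norm u * \<epsilon> y"
      by (simp add: \<epsilon>_def sum_distrib_left)
    also have "\<dots> \<le> norm u * (1/2)"
      using that(2) by (intro mult_left_mono) simp_all
    finally have "norm (L (A y u) - u) \<le> norm u / 2" by simp
    moreover have "norm u \<le> norm (L (A y u)) + norm (L (A y u) - u)"
      by (metis norm_minus_commute norm_triangle_sub)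
    ultimately show ?thesis
      using K(2)[of "A y u"] by (simp add: algebra_simps)
  qed
  \<comment> \<open>For \<open>y\<close> in \<open>S\<close> the difference inside the norm equals
    \<open>A y (v y - v x)\<close>, but written through \<open>w\<close> it is free of the unknown
    \<open>v y\<close>, so its limit can be computed.\<close>
  have "((\<lambda>y. 2 * K * norm (w y - A y (v x))) \<longlongrightarrow> 2 * K * norm (w x - A x (v x))) (at x)"
    by (intro tendsto_mult tendsto_const tendsto_norm tendsto_diff contw contA)
  then have "((\<lambda>y. 2 * K * norm (w y - A y (v x))) \<longlongrightarrow> 0) (at x)"
    using w(2)[OF S(2)] by simp
  moreover have "\<forall>\<^sub>F y in at x. norm (v y - v x) \<le> 2 * K * norm (w y - A y (v x))"
    using ev evS
  proof eventually_elim
    case (elim y)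
    then show ?case
      using lower[of y "v y - v x"] w(2)[of y] by (simp add: linear_diff[OF A(1)])
  qed
  ultimately have "((\<lambda>y. v y - v x) \<longlongrightarrow> 0) (at x)"
    by (rule Lim_null_comparison[rotated])
  then show ?thesis
    unfolding isCont_def by (rule LIM_zero_cancel)
qed

lemma linear_system_solution_differentiable:
  fixes A :: "'a::real_normed_vector \<Rightarrow> 'd::finite_dim_inner \<Rightarrow> 'e::finite_dim_inner"
  assumes S: "open S" "x \<in> S"
    and A: "\<And>y. y \<in> S \<Longrightarrow> linear (A y)" "inj (A x)" "\<And>u. (\<lambda>y. A y u) differentiable at x"
    and w: "w differentiable at x" "\<And>y. y \<in> S \<Longrightarrow> A y (v y) = w y"
    and v: "isCont v x"
  shows "v differentiable at x"
proof -
  obtain L where L: "linear L" "L \<circ> A x = id"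
    using linear_injective_left_inverse[OF A(1)[OF S(2)] A(2)] by blast
  have LA: "L (A x u) = u" for u
    using L(2) by (metis comp_apply id_apply)
  have L_bl: "bounded_linear L"
    using L(1) by (rule linear_imp_bounded_linear_finite_dim)
  define q where "q u y = L (A y u - A x u)" for u y
  obtain A' where A': "((\<lambda>y. A y u) has_derivative A' u) (at x)" for u
    using A(3) unfolding differentiable_def by metis
  obtain w' where w': "(w has_derivative w') (at x)"
    using w(1) unfolding differentiable_def by blast
  have q': "(q u has_derivative (\<lambda>h. L (A' u h - 0))) (at x)" for u
    unfolding q_def
    by (intro bounded_linear.has_derivative[OF L_bl] has_derivative_diff A' has_derivative_const)
  \<comment> \<open>The argument of \<open>A y - A x\<close> is split as
    \<open>v x + (v y - v x)\<close>. The first part gives a differentiable function; in the second,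
    each term is a coefficient tending to zero times the null function \<open>q b\<close>, so its
    derivative at \<open>x\<close> vanishes although \<open>v\<close> is so far only
    continuous.\<close>
  have "((\<lambda>y. ((v y - v x) \<bullet> b)) \<longlongrightarrow> (v x - v x) \<bullet> b) (at x)" for b
    using v unfolding isCont_def by (intro tendsto_inner tendsto_diff tendsto_const)
  then have "((\<lambda>y. ((v y - v x) \<bullet> b) *\<^sub>R q b y) has_derivative (\<lambda>_. 0)) (at x)" for b
    by (intro has_derivative_product_of_null[OF _ _ q']) (auto simp: q_def linear_0[OF L(1)])
  then have "((\<lambda>y. L (w y) - q (v x) y - (\<Sum>b\<in>onb. ((v y - v x) \<bullet> b) *\<^sub>R q b y))
      has_derivative (\<lambda>h. L (w' h) - L (A' (v x) h - 0) - (\<Sum>b\<in>(onb::'d set). 0))) (at x)"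
    by (intro has_derivative_diff bounded_linear.has_derivative[OF L_bl w'] q' has_derivative_sum)
  moreover have "L (w y) - q (v x) y - (\<Sum>b\<in>onb. ((v y - v x) \<bullet> b) *\<^sub>R q b y) = v y" if "y \<in> S" for y
  proof -
    have "linear (\<lambda>u. q u y)"
      unfolding q_def
      using linear_compose[OF linear_compose_sub[OF A(1)[OF that] A(1)[OF S(2)]] L(1)]
      by (simp add: o_def)
    from linear_onb_expansion[OF this, of "v y - v x"]
    have "(\<Sum>b\<in>onb. ((v y - v x) \<bullet> b) *\<^sub>R q b y) = q (v y - v x) y"
      by simp
    also have "\<dots> = L (w y) - v y - q (v x) y"
      unfolding q_def
      by (simp add: linear_diff[OF A(1)[OF that]] linear_diff[OF A(1)[OF S(2)]]
          linear_diff[OF L(1)] LA w(2)[OF that])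
    finally show ?thesis by simp
  qed
  ultimately show ?thesis
    unfolding differentiable_def using has_derivative_transform_within_open[OF _ S] by blast
qed

text \<open>Differentiating \<open>A v = w\<close> in direction \<open>h\<close> shows that \<open>\<partial>\<^sub>h v\<close> solves a system with the same \<open>A\<close>
  and right-hand side \<open>\<partial>\<^sub>h w - (\<partial>\<^sub>h A) v\<close>; hence the induction on \<open>k\<close>.\<close>

lemma Ck_on_linear_system_solution:
  fixes A :: "'a::real_normed_vector \<Rightarrow> 'd::finite_dim_inner \<Rightarrow> 'e::finite_dim_inner"
  assumes S: "open S"
    and A: "\<And>y. y \<in> S \<Longrightarrow> linear (A y)" "\<And>y. y \<in> S \<Longrightarrow> inj (A y)" "\<And>u. Ck_on k S (\<lambda>y. A y u)"
    and w: "Ck_on k S w" "\<And>y. y \<in> S \<Longrightarrow> A y (v y) = w y"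
  shows "Ck_on k S v"
  using A(3) w
proof (induction k arbitrary: w v)
  case 0
  show ?case
    unfolding Ck_on.simps
  proof (rule continuous_at_imp_continuous_on, rule ballI)
    fix x assume "x \<in> S"
    then show "isCont v x"
      using 0 by (intro linear_system_solution_continuous[OF S _ A(1,2)]) auto
  qed
next
  case (Suc k)
  have Ck: "Ck_on k S (\<lambda>y. A y u)" "Ck_on k S w" for u
    using Suc.prems by (simp_all only: Ck_on_Suc_imp)
  \<comment> \<open>The differentiated system contains \<open>v\<close> on its right-hand side, so
    order \<open>k\<close> of \<open>v\<close> itself must come before its derivative is
    treated.\<close>
  have vk: "Ck_on k S v"
    using Ck Suc.prems(3) by (rule Suc.IH)
  define A' where "A' y u h = frechet_derivative (\<lambda>y. A y u) (at y) h" for y u h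
  have A'd: "((\<lambda>y. A y u) has_derivative A' y u) (at y)" if "y \<in> S" for y u
    unfolding A'_def using Ck_on_has_derivative[OF Suc.prems(1) that] .
  have v: "(v has_derivative frechet_derivative v (at x)) (at x)" if "x \<in> S" for x
    unfolding frechet_derivative_works[symmetric]
    using Suc.prems vk[THEN Ck_on_imp_continuous_on] S that
    by (intro linear_system_solution_differentiable[OF S _ A(1,2), where w = w])
      (auto simp: continuous_on_eq_continuous_at)
  \<comment> \<open>Each \<open>A y\<close> is linear in \<open>u\<close>, and uniqueness of
    derivatives carries this over to the derivative in \<open>y\<close>.\<close>
  have A'_linear: "linear (\<lambda>u. A' x u h)" if "x \<in> S" for x h
  proof (rule linearI)
    show "A' x (u + u') h = A' x u h + A' x u' h" for u u'
    proof -
      have "((\<lambda>y. A y u + A y u') has_derivative A' x (u + u')) (at x)"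
        by (rule has_derivative_transform_within_open[OF A'd[OF that] S that])
          (simp add: linear_add[OF A(1)])
      from has_derivative_unique[OF this has_derivative_add[OF A'd A'd]] that
      show ?thesis by metis
    qed
    show "A' x (r *\<^sub>R u) h = r *\<^sub>R A' x u h" for r u
    proof -
      have "((\<lambda>y. r *\<^sub>R A y u) has_derivative A' x (r *\<^sub>R u)) (at x)"
        by (rule has_derivative_transform_within_open[OF A'd[OF that] S that])
          (simp add: linear_scale[OF A(1)])
      from has_derivative_unique[OF this has_derivative_scaleR_right[OF A'd]] that
      show ?thesis by metis
    qed
  qed
  have eq: "A x (frechet_derivative v (at x) h)
      = frechet_derivative w (at x) h + (-1) *\<^sub>R A' x (v x) h" if "x \<in> S" for x h
  proof -
    \<comment> \<open>The product rule is applied to the expanded form of \<open>A y (v y)\<close>,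
      since differentiability in \<open>y\<close> is known for \<open>A y b\<close> with
      \<open>b\<close> fixed.\<close>
    have "((\<lambda>y. \<Sum>b\<in>onb. (v y \<bullet> b) *\<^sub>R A y b) has_derivative
        (\<lambda>h. \<Sum>b\<in>onb. (v x \<bullet> b) *\<^sub>R A' x b h + (frechet_derivative v (at x) h \<bullet> b) *\<^sub>R A x b)) (at x)"
      by (rule has_derivative_sum,
          rule has_derivative_scaleR[OF has_derivative_inner_left[OF v[OF that]] A'd[OF that]])
    moreover have "(\<Sum>b\<in>onb. (v y \<bullet> b) *\<^sub>R A y b) = w y" if "y \<in> S" for y
      by (simp only: linear_onb_expansion[OF A(1)[OF that], symmetric] Suc.prems(3)[OF that])
    ultimately have "(w has_derivative
        (\<lambda>h. \<Sum>b\<in>onb. (v x \<bullet> b) *\<^sub>R A' x b h + (frechet_derivative v (at x) h \<bullet> b) *\<^sub>R A x b)) (at x)"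
      by (rule has_derivative_transform_within_open[OF _ S \<open>x \<in> S\<close>])
    note frechet_derivative_at[OF this, symmetric]
    then have "frechet_derivative w (at x) h
        = (\<Sum>b\<in>onb. (v x \<bullet> b) *\<^sub>R A' x b h) + (\<Sum>b\<in>onb. (frechet_derivative v (at x) h \<bullet> b) *\<^sub>R A x b)"
      by (simp add: sum.distrib)
    also have "(\<Sum>b\<in>onb. (v x \<bullet> b) *\<^sub>R A' x b h) = A' x (v x) h"
      by (rule linear_onb_expansion[OF A'_linear[OF that], symmetric])
    also have "(\<Sum>b\<in>onb. (frechet_derivative v (at x) h \<bullet> b) *\<^sub>R A x b)
        = A x (frechet_derivative v (at x) h)"
      by (rule linear_onb_expansion[OF A(1)[OF that], symmetric])
    finally show ?thesis by simp
  qed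
  have "Ck_on k S (\<lambda>x. frechet_derivative v (at x) h)" for h
  proof (rule Suc.IH[where w = "\<lambda>x. frechet_derivative w (at x) h + (-1) *\<^sub>R A' x (v x) h"])
    have "Ck_on k S (\<lambda>x. A' x u h)" for u
      using Suc.prems(1) by (simp add: A'_def)
    then have "Ck_on k S (\<lambda>x. A' x (v x) h)"
      by (rule Ck_on_linear_family[where A = "\<lambda>x u. A' x u h", OF S _ A'_linear vk])
    then have "Ck_on k S (\<lambda>x. (-1) *\<^sub>R A' x (v x) h)"
      by (rule Ck_on_linear[OF bounded_linear_scaleR_right S])
    then show "Ck_on k S (\<lambda>x. frechet_derivative w (at x) h + (-1) *\<^sub>R A' x (v x) h)"
      using Suc.prems(2) by (intro Ck_on_add[OF S]) simp_all
  qed (rule Ck(1), rule eq)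
  moreover have "\<forall>x\<in>S. v differentiable at x"
    using v unfolding differentiable_def by blast
  ultimately show ?case by simp
qed

section \<open>Charts and tangent spaces\<close>

lemma is_chart_inj_on: "is_chart T c \<Longrightarrow> inj_on (snd c) (fst c)"
  unfolding is_chart_def homeomorphic_map_def
  by (metis openin_subset topspace_subtopology_subset)

lemma chart_inv_chart: "is_chart T c \<Longrightarrow> p \<in> fst c \<Longrightarrow> chart_inv c (snd c p) = p"
  by (simp add: chart_inv_def is_chart_inj_on)

lemma chart_inv_in: "y \<in> chart_image c \<Longrightarrow> chart_inv c y \<in> fst c"
  by (simp add: chart_inv_def chart_image_def inv_into_into)

lemma chart_chart_inv: "y \<in> chart_image c \<Longrightarrow> snd c (chart_inv c y) = y"
  by (simp add: chart_inv_def chart_image_def f_inv_into_f)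

lemma open_chart_image_openin:
  assumes "is_chart T c" "openin T U" "U \<subseteq> fst c"
  shows "open (snd c ` U)"
proof -
  have "openin (subtopology T (fst c)) U"
    using assms(2,3) by (metis inf.absorb1 openin_subtopology)
  then have "openin (top_of_set (chart_image c)) (snd c ` U)"
    using assms(1) homeomorphic_imp_open_map unfolding is_chart_def open_map_def by blast
  then show ?thesis
    using assms(1) openin_open_trans unfolding is_chart_def by blast
qed

text \<open>Near \<open>y\<close> the map \<open>g \<circ> F\<close> is the chart expression of
  \<open>g\<close> after that of \<open>F\<close>. Changes of source chart, of target chart and of
  the chart in a differential are all instances.\<close>

lemma derivative_through_chart:
  assumes "is_chart T d" and N: "open N" "y \<in> N" "\<And>y. y \<in> N \<Longrightarrow> F y \<in> fst d"
    and F: "(snd d \<circ> F) differentiable at y" and g: "(g \<circ> chart_inv d) differentiable at (snd d (F y))"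
  shows "frechet_derivative (g \<circ> F) (at y) u
    = frechet_derivative (g \<circ> chart_inv d) (at (snd d (F y))) (frechet_derivative (snd d \<circ> F) (at y) u)"
proof -
  have g': "(g \<circ> chart_inv d) differentiable at ((snd d \<circ> F) y)"
    using g by simp
  have "((g \<circ> chart_inv d) \<circ> (snd d \<circ> F)) differentiable at y"
    using F g' by (rule differentiable_chain_at)
  then have "frechet_derivative (g \<circ> F) (at y)
      = frechet_derivative ((g \<circ> chart_inv d) \<circ> (snd d \<circ> F)) (at y)"
    using N chart_inv_chart[OF assms(1)] by (intro frechet_derivative_transform_open(2)) auto
  also have "\<dots> = frechet_derivative (g \<circ> chart_inv d) (at (snd d (F y))) \<circ> frechet_derivative (snd d \<circ> F) (at y)"
    using frechet_derivative_compose[OF F g'] unfolding comp_def .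
  finally show ?thesis by simp
qed

lemma charts_at_domain: "c \<in> charts_at P p \<Longrightarrow> p \<in> fst c"
  by (simp add: charts_at_def)

lemma smooth_manifold_is_chart: "smooth_manifold P \<Longrightarrow> c \<in> atlas P \<Longrightarrow> is_chart (topo P) c"
  by (simp add: smooth_manifold_def)

lemma charts_at_is_chart: "smooth_manifold P \<Longrightarrow> c \<in> charts_at P p \<Longrightarrow> is_chart (topo P) c"
  by (simp add: charts_at_def smooth_manifold_is_chart)

lemma chart_at_in: "smooth_manifold P \<Longrightarrow> p \<in> points P \<Longrightarrow> chart_at P p \<in> charts_at P p"
  unfolding chart_at_def charts_at_def smooth_manifold_def by (rule someI_ex) blast

lemma charts_at_points: "smooth_manifold P \<Longrightarrow> c \<in> charts_at P p \<Longrightarrow> p \<in> points P"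
  unfolding charts_at_def smooth_manifold_def by blast

text \<open>Compatibility of charts recast as smoothness of the identity, so that facts about smooth
  maps apply to transition maps.\<close>

lemma smooth_map_identity:
  assumes "smooth_manifold P"
  shows "smooth_map P P (\<lambda>z. z)"
  unfolding smooth_map_def
proof (intro conjI ballI)
  show "continuous_map (topo P) (topo P) (\<lambda>z. z)"
    by simp
  fix c d assume "c \<in> atlas P" "d \<in> atlas P"
  then have "smooth_on (snd c ` (fst c \<inter> fst d)) (snd d \<circ> chart_inv c)"
    using assms unfolding smooth_manifold_def smoothly_compatible_def by blast
  moreover have "fst c \<inter> fst d = {x \<in> fst c. x \<in> fst d}"
    by blast
  ultimately show "smooth_on (snd c ` {x \<in> fst c. x \<in> fst d}) (snd d \<circ> (\<lambda>z. z) \<circ> chart_inv c)"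
    by (simp add: o_def)
qed

text \<open>\<open>Ck_on\<close> uses unrestricted derivatives and is meant for open sets;
  continuity of \<open>f\<close> makes the domain of its coordinate expression open.\<close>

lemma smooth_map_domain_open:
  assumes "smooth_manifold M" "smooth_manifold P" "smooth_map M P f" "c \<in> atlas M" "d \<in> atlas P"
  shows "open (snd c ` {x \<in> fst c. f x \<in> fst d})"
proof -
  note c = smooth_manifold_is_chart[OF assms(1,4)] and d = smooth_manifold_is_chart[OF assms(2,5)]
  have "openin (topo M) {x \<in> topspace (topo M). f x \<in> fst d}"
    using assms(3) d unfolding smooth_map_def is_chart_def by (blast intro: openin_continuous_map_preimage)
  then have "openin (topo M) (fst c \<inter> {x \<in> topspace (topo M). f x \<in> fst d})"
    using c unfolding is_chart_def by (blast intro: openin_Int)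
  moreover have "fst c \<inter> {x \<in> topspace (topo M). f x \<in> fst d} = {x \<in> fst c. f x \<in> fst d}"
    using c openin_subset unfolding is_chart_def by blast
  ultimately show ?thesis
    using open_chart_image_openin[OF c] by simp
qed

lemma smooth_on_differentiable: "smooth_on S f \<Longrightarrow> x \<in> S \<Longrightarrow> f differentiable at x"
  unfolding smooth_on_def by (metis Ck_on.simps(2))

lemma smooth_map_differentiable:
  assumes "smooth_map M P f" "c \<in> charts_at M x" "d \<in> charts_at P (f x)"
  shows "(snd d \<circ> f \<circ> chart_inv c) differentiable at (snd c x)"
proof (rule smooth_on_differentiable)
  show "smooth_on (snd c ` {x \<in> fst c. f x \<in> fst d}) (snd d \<circ> f \<circ> chart_inv c)"
    using assms by (simp add: smooth_map_def charts_at_def)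
  show "snd c x \<in> snd c ` {x \<in> fst c. f x \<in> fst d}"
    using assms(2,3) by (simp add: charts_at_def)
qed

section \<open>Transition maps and components of tangent vectors\<close>

abbreviation chart_transition ::
  "('p, 'e::real_normed_vector) chart \<Rightarrow> ('p, 'e) chart \<Rightarrow> 'p \<Rightarrow> 'e \<Rightarrow> 'e" where
  "chart_transition c d p \<equiv> frechet_derivative (snd d \<circ> chart_inv c) (at (snd c p))"

lemma chart_transition_differentiable:
  assumes "smooth_manifold P" "c \<in> charts_at P p" "d \<in> charts_at P p"
  shows "(snd d \<circ> chart_inv c) differentiable at (snd c p)"
  using smooth_map_differentiable[OF smooth_map_identity[OF assms(1)] assms(2,3)] by (simp add: o_def)

lemma smooth_map_derivative_change_source:
  assumes "smooth_manifold M" "smooth_manifold P" "smooth_map M P f"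
    and "c \<in> charts_at M x" "c' \<in> charts_at M x" "d \<in> charts_at P (f x)"
  shows "frechet_derivative (snd d \<circ> f \<circ> chart_inv c) (at (snd c x)) u
    = frechet_derivative (snd d \<circ> f \<circ> chart_inv c') (at (snd c' x)) (chart_transition c c' x u)"
proof -
  note ch = assms(4,5)[THEN charts_at_is_chart[OF assms(1)]]
  have x: "chart_inv c (snd c x) = x"
    using ch(1) charts_at_domain[OF assms(4)] by (rule chart_inv_chart)
  have "frechet_derivative ((snd d \<circ> f) \<circ> chart_inv c) (at (snd c x)) u
    = frechet_derivative ((snd d \<circ> f) \<circ> chart_inv c') (at (snd c' (chart_inv c (snd c x))))
        (chart_transition c c' x u)"
  proof (rule derivative_through_chart[OF ch(2)])
    show "open (snd c ` {z \<in> fst c. z \<in> fst c'})"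
      using smooth_map_domain_open[OF assms(1,1) smooth_map_identity[OF assms(1)]] assms(4,5)
      by (simp add: charts_at_def)
    show "snd c x \<in> snd c ` {z \<in> fst c. z \<in> fst c'}"
      using assms(4,5) by (simp add: charts_at_def)
    show "chart_inv c y \<in> fst c'" if "y \<in> snd c ` {z \<in> fst c. z \<in> fst c'}" for y
      using that chart_inv_chart[OF ch(1)] by auto
    show "(snd c' \<circ> chart_inv c) differentiable at (snd c x)"
      using assms by (intro chart_transition_differentiable)
    show "(snd d \<circ> f \<circ> chart_inv c') differentiable at (snd c' (chart_inv c (snd c x)))"
      using smooth_map_differentiable[OF assms(3,5,6)] x by simp
  qed
  then show ?thesis
    using x by simp
qed

lemma smooth_map_derivative_change_target:
  assumes "smooth_manifold M" "smooth_manifold P" "smooth_map M P f"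
    and "c \<in> charts_at M x" "d \<in> charts_at P (f x)" "d' \<in> charts_at P (f x)"
  shows "frechet_derivative (snd d' \<circ> f \<circ> chart_inv c) (at (snd c x)) u
    = chart_transition d d' (f x) (frechet_derivative (snd d \<circ> f \<circ> chart_inv c) (at (snd c x)) u)"
proof -
  have c: "is_chart (topo M) c" and d: "is_chart (topo P) d"
    using assms by (auto intro: charts_at_is_chart)
  have x: "chart_inv c (snd c x) = x"
    using c charts_at_domain[OF assms(4)] by (rule chart_inv_chart)
  have "frechet_derivative (snd d' \<circ> (f \<circ> chart_inv c)) (at (snd c x)) u
    = frechet_derivative (snd d' \<circ> chart_inv d) (at (snd d ((f \<circ> chart_inv c) (snd c x))))
        (frechet_derivative (snd d \<circ> (f \<circ> chart_inv c)) (at (snd c x)) u)"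
  proof (rule derivative_through_chart[OF d])
    show "open (snd c ` {z \<in> fst c. f z \<in> fst d})"
      using smooth_map_domain_open[OF assms(1-3)] assms(4,5) by (simp add: charts_at_def)
    show "snd c x \<in> snd c ` {z \<in> fst c. f z \<in> fst d}"
      using assms(4,5) by (simp add: charts_at_def)
    show "(f \<circ> chart_inv c) y \<in> fst d" if "y \<in> snd c ` {z \<in> fst c. f z \<in> fst d}" for y
      using that chart_inv_chart[OF c] by auto
    show "(snd d \<circ> (f \<circ> chart_inv c)) differentiable at (snd c x)"
      using smooth_map_differentiable[OF assms(3-5)] by (simp add: o_assoc)
    show "(snd d' \<circ> chart_inv d) differentiable at (snd d ((f \<circ> chart_inv c) (snd c x)))"
      using chart_transition_differentiable[OF assms(2,5,6)] x by simp
  qed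
  then show ?thesis
    using x by (simp add: o_assoc)
qed

text \<open>The change of target chart for the identity map. It lets a single component extend
  consistently to all charts.\<close>

lemma chart_transition_cocycle:
  assumes "smooth_manifold P" "c \<in> charts_at P p" "d \<in> charts_at P p" "e \<in> charts_at P p"
  shows "chart_transition d e p (chart_transition c d p u) = chart_transition c e p u"
  using smooth_map_derivative_change_target[OF assms(1,1) smooth_map_identity[OF assms(1)] assms(2-4), of u]
  by (simp add: o_def)

lemma chart_transition_self:
  assumes "smooth_manifold P" "c \<in> charts_at P p"
  shows "chart_transition c c p u = u"
proof -
  have c: "is_chart (topo P) c" "p \<in> fst c"
    using assms by (auto intro: charts_at_is_chart charts_at_domain)
  have "frechet_derivative (snd c \<circ> chart_inv c) (at (snd c p)) = frechet_derivative (\<lambda>y. y) (at (snd c p))"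
  proof (rule frechet_derivative_transform_open(2))
    show "open (chart_image c)"
      using c by (simp add: is_chart_def)
    show "snd c p \<in> chart_image c"
      using c by (simp add: chart_image_def)
  qed (auto simp: chart_chart_inv)
  then show ?thesis by simp
qed

text \<open>Inverse to reading the component at \<open>c\<close>; it identifies the tangent space
  with the model space.\<close>

definition tangent_vector :: "('p, 'e::finite_dim_inner) manifold \<Rightarrow> 'p \<Rightarrow> ('p, 'e) chart \<Rightarrow> 'e \<Rightarrow> ('p, 'e) tvec"
  where "tangent_vector P p c u = (\<lambda>d. if d \<in> charts_at P p then chart_transition c d p u else 0)"

lemma tangent_vector_in_tangent_space:
  "smooth_manifold P \<Longrightarrow> c \<in> charts_at P p \<Longrightarrow> tangent_vector P p c u \<in> tangent_space P p"
  by (simp add: tangent_vector_def tangent_space_def chart_transition_cocycle)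

lemma tangent_vector_component:
  "smooth_manifold P \<Longrightarrow> c \<in> charts_at P p \<Longrightarrow> tangent_vector P p c u c = u"
  by (simp add: tangent_vector_def chart_transition_self)

lemma tangent_space_component:
  "v \<in> tangent_space P p \<Longrightarrow> c \<in> charts_at P p \<Longrightarrow> d \<in> charts_at P p
    \<Longrightarrow> v d = chart_transition c d p (v c)"
  unfolding tangent_space_def by blast

lemma tangent_space_outside: "v \<in> tangent_space P p \<Longrightarrow> c \<notin> charts_at P p \<Longrightarrow> v c = 0"
  unfolding tangent_space_def by blast

lemma tangent_vector_of_component:
  "v \<in> tangent_space P p \<Longrightarrow> c \<in> charts_at P p \<Longrightarrow> tangent_vector P p c (v c) = v"
proof (rule ext)
  fix d assume v: "v \<in> tangent_space P p" and c: "c \<in> charts_at P p"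
  show "tangent_vector P p c (v c) d = v d"
    using tangent_space_outside[OF v]
    by (simp add: tangent_vector_def tangent_space_component[OF v c, symmetric])
qed

lemma tangent_space_eqI:
  "v \<in> tangent_space P p \<Longrightarrow> w \<in> tangent_space P p \<Longrightarrow> c \<in> charts_at P p \<Longrightarrow> v c = w c \<Longrightarrow> v = w"
  by (metis tangent_vector_of_component)

lemma tangent_space_linear_combination:
  assumes "smooth_manifold P" "v \<in> tangent_space P p" "w \<in> tangent_space P p"
  shows "(\<lambda>c. r *\<^sub>R v c + s *\<^sub>R w c) \<in> tangent_space P p"
proof -
  have "r *\<^sub>R v d + s *\<^sub>R w d = chart_transition c d p (r *\<^sub>R v c + s *\<^sub>R w c)"
    if "c \<in> charts_at P p" "d \<in> charts_at P p" for c d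
  proof -
    have "linear (chart_transition c d p)"
      using chart_transition_differentiable[OF assms(1) that] by (rule linear_frechet_derivative)
    then show ?thesis
      by (simp only: linear_add linear_scale tangent_space_component[OF assms(2) that, symmetric]
          tangent_space_component[OF assms(3) that, symmetric])
  qed
  moreover have "r *\<^sub>R v c + s *\<^sub>R w c = 0" if "c \<notin> charts_at P p" for c
    using tangent_space_outside[OF assms(2) that] tangent_space_outside[OF assms(3) that] by simp
  ultimately show ?thesis
    unfolding tangent_space_def by blast
qed

section \<open>Tangent maps and differentials in arbitrary charts\<close>

lemma tangent_map_component:
  assumes "smooth_manifold M" "smooth_manifold P" "smooth_map M P f"
    and "c \<in> charts_at M x" "d \<in> charts_at P (f x)" "v \<in> tangent_space M x"
  shows "tangent_map M P f x v d = frechet_derivative (snd d \<circ> f \<circ> chart_inv c) (at (snd c x)) (v c)"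
proof -
  have "chart_at M x \<in> charts_at M x"
    using assms(1,4) by (intro chart_at_in charts_at_points)
  then show ?thesis
    using smooth_map_derivative_change_source[OF assms(1-4) _ assms(5), of "chart_at M x" "v c"]
      tangent_space_component[OF assms(6,4)] assms(5)
    by (simp add: tangent_map_def Let_def)
qed

text \<open>Holds for every family \<open>v\<close>, because \<open>tangent_map\<close> reads one
  component and pushes it through the derivatives in all target charts.\<close>

lemma tangent_map_in_tangent_space:
  assumes "smooth_manifold M" "smooth_manifold P" "smooth_map M P f" "x \<in> points M"
  shows "tangent_map M P f x v \<in> tangent_space P (f x)"
  unfolding tangent_space_def
proof (intro CollectI conjI ballI allI impI)
  fix d d' assume "d \<in> charts_at P (f x)" "d' \<in> charts_at P (f x)"
  then show "tangent_map M P f x v d' = chart_transition d d' (f x) (tangent_map M P f x v d)"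
    using smooth_map_derivative_change_target[OF assms(1-3) chart_at_in[OF assms(1,4)], of d d']
    by (simp only: tangent_map_def Let_def if_True)
qed (simp add: tangent_map_def)

lemma smooth_function_differentiable:
  assumes "smooth_function P H" "c \<in> charts_at P p"
  shows "(H \<circ> chart_inv c) differentiable at (snd c p)"
proof (rule smooth_on_differentiable)
  show "smooth_on (chart_image c) (H \<circ> chart_inv c)" "snd c p \<in> chart_image c"
    using assms by (auto simp: smooth_function_def chart_image_def charts_at_def)
qed

lemma differential_component:
  assumes "smooth_manifold P" "smooth_function P H" "c \<in> charts_at P p" "v \<in> tangent_space P p"
  shows "differential P H p v = frechet_derivative (H \<circ> chart_inv c) (at (snd c p)) (v c)"
proof -
  define d where "d = chart_at P p"
  have d: "d \<in> charts_at P p"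
    unfolding d_def using assms(1,3) by (intro chart_at_in charts_at_points)
  have cd: "is_chart (topo P) c" "is_chart (topo P) d"
    using assms(1,3) d by (auto intro: charts_at_is_chart)
  have x: "chart_inv d (snd d p) = p"
    using cd(2) charts_at_domain[OF d] by (rule chart_inv_chart)
  have "frechet_derivative (H \<circ> chart_inv d) (at (snd d p)) (v d)
    = frechet_derivative (H \<circ> chart_inv c) (at (snd c (chart_inv d (snd d p)))) (chart_transition d c p (v d))"
  proof (rule derivative_through_chart[OF cd(1)])
    show "open (snd d ` {z \<in> fst d. z \<in> fst c})"
      using smooth_map_domain_open[OF assms(1,1) smooth_map_identity[OF assms(1)]] assms(3) d
      by (simp add: charts_at_def)
    show "snd d p \<in> snd d ` {z \<in> fst d. z \<in> fst c}"
      using assms(3) d by (simp add: charts_at_def)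
    show "chart_inv d y \<in> fst c" if "y \<in> snd d ` {z \<in> fst d. z \<in> fst c}" for y
      using that chart_inv_chart[OF cd(2)] by auto
    show "(snd c \<circ> chart_inv d) differentiable at (snd d p)"
      using assms d by (intro chart_transition_differentiable)
    show "(H \<circ> chart_inv c) differentiable at (snd c (chart_inv d (snd d p)))"
      using smooth_function_differentiable[OF assms(2,3)] x by simp
  qed
  then show ?thesis
    using x tangent_space_component[OF assms(4) d assms(3)] assms(4)
    by (simp add: differential_def Let_def d_def)
qed

section \<open>Covectors and the sharp map\<close>

lemma cotangent_spaceD:
  "\<beta> \<in> cotangent_space P p \<Longrightarrow> v \<in> tangent_space P p \<Longrightarrow> w \<in> tangent_space P p
    \<Longrightarrow> \<beta> (\<lambda>c. r *\<^sub>R v c + s *\<^sub>R w c) = r * \<beta> v + s * \<beta> w"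
  "\<beta> \<in> cotangent_space P p \<Longrightarrow> v \<notin> tangent_space P p \<Longrightarrow> \<beta> v = 0"
  unfolding cotangent_space_def by blast+

lemma cotangent_space_linear_combination:
  assumes "\<beta> \<in> cotangent_space P p" "\<gamma> \<in> cotangent_space P p"
  shows "(\<lambda>v. r * \<beta> v + s * \<gamma> v) \<in> cotangent_space P p"
  unfolding cotangent_space_def
  by (intro CollectI conjI ballI allI impI)
    (simp_all add: cotangent_spaceD[OF assms(1)] cotangent_spaceD[OF assms(2)] algebra_simps)

lemma chart_covector_in_cotangent_space:
  assumes "smooth_manifold P"
  shows "chart_covector P c a p \<in> cotangent_space P p"
  unfolding cotangent_space_def chart_covector_def
  using tangent_space_linear_combination[OF assms]
  by (intro CollectI conjI ballI allI impI) (simp_all add: inner_add_right)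

text \<open>The components of a covector are its values on the coordinate vectors. Linearity on
  families is first transported to a linear form on the model space, which is then expanded.\<close>

lemma covector_eq_chart_covector:
  assumes "smooth_manifold P" "c \<in> charts_at P p" "\<beta> \<in> cotangent_space P p"
  shows "\<beta> = chart_covector P c (\<Sum>b\<in>onb. \<beta> (tangent_vector P p c b) *\<^sub>R b) p"
proof (rule ext)
  fix v
  note T = tangent_vector_in_tangent_space[OF assms(1,2)]
  show "\<beta> v = chart_covector P c (\<Sum>b\<in>onb. \<beta> (tangent_vector P p c b) *\<^sub>R b) p v"
  proof (cases "v \<in> tangent_space P p")
    case True
    have comb: "\<beta> (tangent_vector P p c (r *\<^sub>R u + s *\<^sub>R w))
        = r * \<beta> (tangent_vector P p c u) + s * \<beta> (tangent_vector P p c w)" for r s u w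
    proof -
      have "tangent_vector P p c (r *\<^sub>R u + s *\<^sub>R w)
          = (\<lambda>d. r *\<^sub>R tangent_vector P p c u d + s *\<^sub>R tangent_vector P p c w d)"
        by (rule tangent_space_eqI[OF T tangent_space_linear_combination[OF assms(1) T T] assms(2)])
          (simp add: tangent_vector_component[OF assms(1,2)])
      then show ?thesis
        using cotangent_spaceD(1)[OF assms(3) T T] by simp
    qed
    have "linear (\<lambda>u. \<beta> (tangent_vector P p c u))"
    proof (rule linearI)
      show "\<beta> (tangent_vector P p c (u + w)) = \<beta> (tangent_vector P p c u) + \<beta> (tangent_vector P p c w)" for u w
        using comb[of 1 u 1 w] by simp
      show "\<beta> (tangent_vector P p c (r *\<^sub>R u)) = r *\<^sub>R \<beta> (tangent_vector P p c u)" for r u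
        using comb[of r u 0 u] by simp
    qed
    from linear_onb_expansion[OF this, of "v c"]
    have "\<beta> v = (\<Sum>b\<in>onb. (v c \<bullet> b) *\<^sub>R \<beta> (tangent_vector P p c b))"
      by (simp only: tangent_vector_of_component[OF True assms(2)])
    then show ?thesis
      using True by (simp add: chart_covector_def inner_sum_left inner_commute[of "v c"] mult.commute)
  next
    case False
    then show ?thesis
      using cotangent_spaceD(2)[OF assms(3)] by (simp add: chart_covector_def)
  qed
qed

lemma differential_in_cotangent_space:
  assumes "smooth_manifold P" "smooth_function P H" "p \<in> points P"
  shows "differential P H p \<in> cotangent_space P p"
proof -
  note c = chart_at_in[OF assms(1,3)]
  have "linear (frechet_derivative (H \<circ> chart_inv (chart_at P p)) (at (snd (chart_at P p) p)))"
    using smooth_function_differentiable[OF assms(2) c] by (rule linear_frechet_derivative)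
  then show ?thesis
    unfolding cotangent_space_def differential_def Let_def
    using tangent_space_linear_combination[OF assms(1)]
    by (intro CollectI conjI ballI allI impI) (simp_all add: linear_add linear_scale)
qed

section \<open>Skew bilinear forms and the sharp map\<close>

lemma almost_poisson_skew:
  "almost_poisson P \<Lambda> \<Longrightarrow> p \<in> points P \<Longrightarrow> \<beta> \<in> cotangent_space P p \<Longrightarrow> \<gamma> \<in> cotangent_space P p
    \<Longrightarrow> \<Lambda> p \<beta> \<gamma> = - \<Lambda> p \<gamma> \<beta>"
  unfolding almost_poisson_def by blast

lemma almost_poisson_linear_left:
  "almost_poisson P \<Lambda> \<Longrightarrow> p \<in> points P \<Longrightarrow> \<beta> \<in> cotangent_space P p \<Longrightarrow> \<gamma> \<in> cotangent_space P p
    \<Longrightarrow> \<delta> \<in> cotangent_space P p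
    \<Longrightarrow> \<Lambda> p (\<lambda>v. r * \<beta> v + s * \<gamma> v) \<delta> = r * \<Lambda> p \<beta> \<delta> + s * \<Lambda> p \<gamma> \<delta>"
  unfolding almost_poisson_def by blast

text \<open>Exchanging the arguments before and after reduces this to linearity in the first
  slot.\<close>

lemma almost_poisson_linear_right:
  assumes "almost_poisson P \<Lambda>" "p \<in> points P" "\<beta> \<in> cotangent_space P p" "\<gamma> \<in> cotangent_space P p"
    "\<delta> \<in> cotangent_space P p"
  shows "\<Lambda> p \<delta> (\<lambda>v. r * \<beta> v + s * \<gamma> v) = r * \<Lambda> p \<delta> \<beta> + s * \<Lambda> p \<delta> \<gamma>"
proof -
  have "\<Lambda> p \<delta> (\<lambda>v. r * \<beta> v + s * \<gamma> v) = - \<Lambda> p (\<lambda>v. r * \<beta> v + s * \<gamma> v) \<delta>"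
    by (rule almost_poisson_skew[OF assms(1,2,5) cotangent_space_linear_combination[OF assms(3,4)]])
  also have "\<dots> = r * (- \<Lambda> p \<beta> \<delta>) + s * (- \<Lambda> p \<gamma> \<delta>)"
    using almost_poisson_linear_left[OF assms] by simp
  finally show ?thesis
    by (simp only: almost_poisson_skew[OF assms(1,2,5,3)] almost_poisson_skew[OF assms(1,2,5,4)])
qed

lemma linear_almost_poisson_chart_covector:
  assumes "smooth_manifold P" "almost_poisson P \<Lambda>" "p \<in> points P" "\<beta> \<in> cotangent_space P p"
  shows "linear (\<lambda>a. \<Lambda> p \<beta> (chart_covector P c a p))"
proof -
  have "chart_covector P c (r *\<^sub>R a + s *\<^sub>R b) p
      = (\<lambda>v. r * chart_covector P c a p v + s * chart_covector P c b p v)" for r s a b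
    by (auto simp: chart_covector_def inner_add_left)
  then have comb: "\<Lambda> p \<beta> (chart_covector P c (r *\<^sub>R a + s *\<^sub>R b) p)
      = r * \<Lambda> p \<beta> (chart_covector P c a p) + s * \<Lambda> p \<beta> (chart_covector P c b p)" for r s a b
    using almost_poisson_linear_right[OF assms(2,3) _ _ assms(4)]
      chart_covector_in_cotangent_space[OF assms(1)] by simp
  show ?thesis
  proof (rule linearI)
    show "\<Lambda> p \<beta> (chart_covector P c (a + b) p)
        = \<Lambda> p \<beta> (chart_covector P c a p) + \<Lambda> p \<beta> (chart_covector P c b p)" for a b
      using comb[of 1 a 1 b] by simp
    show "\<Lambda> p \<beta> (chart_covector P c (r *\<^sub>R a) p) = r *\<^sub>R \<Lambda> p \<beta> (chart_covector P c a p)" for r a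
      using comb[of r a 0 a] by simp
  qed
qed

text \<open>Covectors with constant components \<open>a\<close> read off all inner products
  \<open>a \<bullet> v c\<close>, and these determine the component.\<close>

lemma tangent_vector_eq_if_covectors_agree:
  assumes "smooth_manifold P" "p \<in> points P" "v \<in> tangent_space P p" "w \<in> tangent_space P p"
    and "\<And>\<beta>. \<beta> \<in> cotangent_space P p \<Longrightarrow> \<beta> v = \<beta> w"
  shows "v = w"
proof -
  note c = chart_at_in[OF assms(1,2)]
  have "a \<bullet> v (chart_at P p) = a \<bullet> w (chart_at P p)" for a
    using assms(5)[OF chart_covector_in_cotangent_space[OF assms(1), of "chart_at P p" a]] assms(3,4)
    by (simp add: chart_covector_def)
  then have "v (chart_at P p) = w (chart_at P p)"
    by (metis inner_commute vector_eq_rdot)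
  then show ?thesis
    by (rule tangent_space_eqI[OF assms(3,4) c])
qed

text \<open>Justifies the definite description in \<open>sharp\<close>. In a chart the vector is the
  Riesz representative of the linear form that sends the components of a covector to its pairing
  with \<open>\<beta>\<close> under \<open>\<Lambda>\<close>; uniqueness is separation by
  covectors.\<close>

lemma sharp_characterization:
  assumes "smooth_manifold P" "almost_poisson P \<Lambda>" "p \<in> points P" "\<beta> \<in> cotangent_space P p"
  shows "sharp P \<Lambda> p \<beta> \<in> tangent_space P p \<and> (\<forall>\<gamma>\<in>cotangent_space P p. \<gamma> (sharp P \<Lambda> p \<beta>) = \<Lambda> p \<beta> \<gamma>)"
proof -
  define c where "c = chart_at P p"
  have c: "c \<in> charts_at P p"
    unfolding c_def by (rule chart_at_in[OF assms(1,3)])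
  define f where "f a = \<Lambda> p \<beta> (chart_covector P c a p)" for a
  have f: "f a = (\<Sum>b\<in>onb. (a \<bullet> b) *\<^sub>R f b)" for a
    unfolding f_def by (rule linear_onb_expansion[OF linear_almost_poisson_chart_covector[OF assms]])
  define v where "v = tangent_vector P p c (\<Sum>b\<in>onb. f b *\<^sub>R b)"
  have v: "v \<in> tangent_space P p"
    unfolding v_def by (rule tangent_vector_in_tangent_space[OF assms(1) c])
  have pairing: "\<gamma> v = \<Lambda> p \<beta> \<gamma>" if \<gamma>: "\<gamma> \<in> cotangent_space P p" for \<gamma>
  proof -
    obtain a where a: "\<gamma> = chart_covector P c a p"
      using covector_eq_chart_covector[OF assms(1) c \<gamma>] by blast
    have "\<gamma> v = a \<bullet> (\<Sum>b\<in>onb. f b *\<^sub>R b)"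
      using v by (simp add: a chart_covector_def v_def tangent_vector_component[OF assms(1) c])
    also have "\<dots> = (\<Sum>b\<in>onb. (a \<bullet> b) *\<^sub>R f b)"
      by (simp add: inner_sum_right mult.commute)
    also have "\<dots> = f a"
      by (rule f[symmetric])
    finally show ?thesis
      by (simp only: f_def a)
  qed
  have "\<exists>!v. v \<in> tangent_space P p \<and> (\<forall>\<gamma>\<in>cotangent_space P p. \<gamma> v = \<Lambda> p \<beta> \<gamma>)"
  proof (rule ex1I[of _ v])
    show "v \<in> tangent_space P p \<and> (\<forall>\<gamma>\<in>cotangent_space P p. \<gamma> v = \<Lambda> p \<beta> \<gamma>)"
      using v pairing by blast
    fix w assume w: "w \<in> tangent_space P p \<and> (\<forall>\<gamma>\<in>cotangent_space P p. \<gamma> w = \<Lambda> p \<beta> \<gamma>)"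
    then show "w = v"
      using v pairing by (intro tangent_vector_eq_if_covectors_agree[OF assms(1,3)]) auto
  qed
  from theI'[OF this] show ?thesis
    unfolding sharp_def .
qed

lemma sharp_in_tangent_space:
  "smooth_manifold P \<Longrightarrow> almost_poisson P \<Lambda> \<Longrightarrow> p \<in> points P \<Longrightarrow> \<beta> \<in> cotangent_space P p
    \<Longrightarrow> sharp P \<Lambda> p \<beta> \<in> tangent_space P p"
  by (rule sharp_characterization[THEN conjunct1])

lemma covector_sharp:
  assumes "smooth_manifold P" "almost_poisson P \<Lambda>" "p \<in> points P" "\<beta> \<in> cotangent_space P p"
    and "\<gamma> \<in> cotangent_space P p"
  shows "\<gamma> (sharp P \<Lambda> p \<beta>) = \<Lambda> p \<beta> \<gamma>"
  using sharp_characterization[OF assms(1-4)] assms(5) by blast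

lemma sharp_kernel_iff:
  assumes "smooth_manifold P" "almost_poisson P \<Lambda>" "p \<in> points P" "\<beta> \<in> cotangent_space P p"
  shows "\<beta> \<in> sharp_kernel P \<Lambda> p \<longleftrightarrow> (\<forall>\<gamma>\<in>cotangent_space P p. \<Lambda> p \<beta> \<gamma> = 0)"
proof -
  \<comment> \<open>The zero family is reached as a combination, with coefficients 0, of a vector
    already known to be tangent.\<close>
  have zero: "(\<lambda>_. 0) \<in> tangent_space P p"
    using tangent_space_linear_combination[OF assms(1) sharp_in_tangent_space[OF assms] sharp_in_tangent_space[OF assms], of 0 0]
    by simp
  have at_zero: "\<gamma> (\<lambda>_. 0) = 0" if "\<gamma> \<in> cotangent_space P p" for \<gamma>
    using cotangent_spaceD(1)[OF that sharp_in_tangent_space[OF assms] sharp_in_tangent_space[OF assms], of 0 0]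
    by simp
  have "sharp P \<Lambda> p \<beta> = (\<lambda>_. 0) \<longleftrightarrow> (\<forall>\<gamma>\<in>cotangent_space P p. \<gamma> (sharp P \<Lambda> p \<beta>) = 0)"
  proof
    assume "\<forall>\<gamma>\<in>cotangent_space P p. \<gamma> (sharp P \<Lambda> p \<beta>) = 0"
    then show "sharp P \<Lambda> p \<beta> = (\<lambda>_. 0)"
      by (intro tangent_vector_eq_if_covectors_agree[OF assms(1,3) sharp_in_tangent_space[OF assms] zero])
        (simp add: at_zero)
  qed (simp add: at_zero)
  also have "\<dots> \<longleftrightarrow> (\<forall>\<gamma>\<in>cotangent_space P p. \<Lambda> p \<beta> \<gamma> = 0)"
    by (intro ball_cong refl arg_cong2[where f = "(=)"] covector_sharp[OF assms])
  finally show ?thesis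
    using assms(4) by (simp add: sharp_kernel_def)
qed

text \<open>Linearity of the sharp map in the form that the decomposition of \<open>dH\<close> uses.
  Testing against covectors reduces it to linearity of \<open>\<Lambda>\<close>.\<close>

lemma diff_in_sharp_kernel_iff:
  assumes "smooth_manifold P" "almost_poisson P \<Lambda>" "p \<in> points P" "\<beta> \<in> cotangent_space P p"
    "\<gamma> \<in> cotangent_space P p"
  shows "(\<lambda>v. \<beta> v - \<gamma> v) \<in> sharp_kernel P \<Lambda> p \<longleftrightarrow> sharp P \<Lambda> p \<beta> = sharp P \<Lambda> p \<gamma>"
proof -
  have "(\<lambda>v. \<beta> v - \<gamma> v) \<in> cotangent_space P p"
    using cotangent_space_linear_combination[OF assms(4,5), of 1 "-1"] by simp
  moreover have "\<Lambda> p (\<lambda>v. \<beta> v - \<gamma> v) \<delta> = \<Lambda> p \<beta> \<delta> - \<Lambda> p \<gamma> \<delta>" if "\<delta> \<in> cotangent_space P p" for \<delta>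
    using almost_poisson_linear_left[OF assms(2-5) that, of 1 "-1"] by simp
  ultimately have "(\<lambda>v. \<beta> v - \<gamma> v) \<in> sharp_kernel P \<Lambda> p
      \<longleftrightarrow> (\<forall>\<delta>\<in>cotangent_space P p. \<Lambda> p \<beta> \<delta> = \<Lambda> p \<gamma> \<delta>)"
    using sharp_kernel_iff[OF assms(1-3)] by simp
  also have "\<dots> \<longleftrightarrow> (\<forall>\<delta>\<in>cotangent_space P p. \<delta> (sharp P \<Lambda> p \<beta>) = \<delta> (sharp P \<Lambda> p \<gamma>))"
    by (intro ball_cong refl arg_cong2[where f = "(=)"] covector_sharp[OF assms(1-3), symmetric] assms(4,5))
  also have "\<dots> \<longleftrightarrow> sharp P \<Lambda> p \<beta> = sharp P \<Lambda> p \<gamma>"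
  proof
    assume "\<forall>\<delta>\<in>cotangent_space P p. \<delta> (sharp P \<Lambda> p \<beta>) = \<delta> (sharp P \<Lambda> p \<gamma>)"
    then show "sharp P \<Lambda> p \<beta> = sharp P \<Lambda> p \<gamma>"
      by (intro tangent_vector_eq_if_covectors_agree[OF assms(1,3)]
          sharp_in_tangent_space[OF assms(1-3)] assms(4,5)) simp
  qed simp
  finally show ?thesis .
qed

section \<open>Embeddings\<close>

definition image_chart :: "('m, 'd) manifold \<Rightarrow> ('m \<Rightarrow> 'p) \<Rightarrow> ('m, 'd) chart \<Rightarrow> ('p, 'd) chart" where
  "image_chart M f c = (f ` fst c, snd c \<circ> inv_into (points M) f)"

lemma atlas_image_manifold: "atlas (image_manifold M P f) = image_chart M f ` atlas M"
  by (simp add: image_manifold_def image_chart_def)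

lemma topo_image_manifold: "topo (image_manifold M P f) = subtopology (topo P) (f ` points M)"
  by (simp add: image_manifold_def)

lemma smooth_embedding_inj_on: "smooth_embedding M P f \<Longrightarrow> inj_on f (points M)"
  unfolding smooth_embedding_def embedding_map_def homeomorphic_map_def by blast

lemma smooth_embedding_smooth_map: "smooth_embedding M P f \<Longrightarrow> smooth_map M P f"
  by (simp add: smooth_embedding_def)

lemma smooth_map_in_points: "smooth_map M P f \<Longrightarrow> x \<in> points M \<Longrightarrow> f x \<in> points P"
  unfolding smooth_map_def using continuous_map_image_subset_topspace by blast

lemma points_image_manifold:
  assumes "smooth_map M P f"
  shows "points (image_manifold M P f) = f ` points M"
  using smooth_map_in_points[OF assms] by (auto simp: topo_image_manifold)

lemma chart_domain_subset: "smooth_manifold M \<Longrightarrow> c \<in> atlas M \<Longrightarrow> fst c \<subseteq> points M"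
  unfolding smooth_manifold_def by blast

context
  fixes M :: "('m, 'd::finite_dim_inner) manifold" and P :: "('p, 'e::finite_dim_inner) manifold"
    and f :: "'m \<Rightarrow> 'p"
  assumes M: "smooth_manifold M" and P: "smooth_manifold P" and f: "smooth_embedding M P f"
begin

lemma image_chart_apply: "x \<in> points M \<Longrightarrow> snd (image_chart M f c) (f x) = snd c x"
  by (simp add: image_chart_def inv_into_f_f[OF smooth_embedding_inj_on[OF f]])

lemma image_chart_image: "U \<subseteq> points M \<Longrightarrow> snd (image_chart M f c) ` f ` U = snd c ` U"
  unfolding image_image by (rule image_cong[OF refl]) (simp add: image_chart_apply subset_iff)

lemma fst_image_chart: "fst (image_chart M f c) = f ` fst c"
  by (simp add: image_chart_def)

lemma chart_image_image_chart: "c \<in> atlas M \<Longrightarrow> chart_image (image_chart M f c) = chart_image c"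
  unfolding chart_image_def fst_image_chart by (intro image_chart_image chart_domain_subset[OF M])

text \<open>Says that in a transported chart the inclusion of the image has the coordinate
  expression of \<open>f\<close>. As \<open>chart_inv\<close> is an \<open>inv_into\<close>,
  injectivity of the transported chart has to be established.\<close>

lemma chart_inv_image_chart:
  assumes c: "c \<in> atlas M" and "y \<in> chart_image c"
  shows "chart_inv (image_chart M f c) y = f (chart_inv c y)"
proof -
  note sub = chart_domain_subset[OF M c] and x = chart_inv_in[OF assms(2)]
  have "inj_on (snd (image_chart M f c)) (fst (image_chart M f c))"
    unfolding fst_image_chart
  proof (rule inj_onI)
    fix p q assume "p \<in> f ` fst c" "q \<in> f ` fst c"
      and eq: "snd (image_chart M f c) p = snd (image_chart M f c) q"
    then obtain a b where ab: "a \<in> fst c" "b \<in> fst c" "p = f a" "q = f b"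
      by blast
    then have "snd c a = snd c b"
      using eq sub by (simp add: image_chart_apply subset_iff)
    then show "p = q"
      using is_chart_inj_on[OF smooth_manifold_is_chart[OF M c]] ab by (simp add: inj_on_eq_iff)
  qed
  moreover have "f (chart_inv c y) \<in> fst (image_chart M f c)"
    using x by (simp add: fst_image_chart)
  moreover have "snd (image_chart M f c) (f (chart_inv c y)) = y"
    using x sub chart_chart_inv[OF assms(2)] by (simp add: image_chart_apply subset_iff)
  ultimately show ?thesis
    unfolding chart_inv_def[of "image_chart M f c"] by (rule inv_into_f_eq)
qed

lemma is_chart_image_chart:
  assumes c: "c \<in> atlas M"
  shows "is_chart (topo (image_manifold M P f)) (image_chart M f c)"
proof -
  note sub = chart_domain_subset[OF M c] and chart = smooth_manifold_is_chart[OF M c]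
  define N where "N = topo (image_manifold M P f)"
  have hom: "homeomorphic_map (topo M) N f"
    using f unfolding smooth_embedding_def embedding_map_def N_def topo_image_manifold by blast
  then obtain g where g: "homeomorphic_maps (topo M) N f g"
    unfolding homeomorphic_map_maps by blast
  have gf: "g (f x) = x" if "x \<in> points M" for x
    using g that by (simp add: homeomorphic_maps_def)
  have open_N: "openin N (f ` fst c)"
    using hom chart homeomorphic_imp_open_map unfolding is_chart_def open_map_def by blast
  have top: "topspace (subtopology N (f ` fst c)) = f ` fst c"
    using openin_subset[OF open_N] by auto
  have "homeomorphic_map N (topo M) g"
    using g homeomorphic_maps_map by blast
  moreover have "g ` (topspace N \<inter> f ` fst c) = topspace (topo M) \<inter> fst c"
  proof -
    have "topspace N \<inter> f ` fst c = f ` fst c"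
      using openin_subset[OF open_N] by blast
    moreover have "g ` f ` fst c = fst c"
      unfolding image_image using sub by (simp add: gf subset_iff)
    ultimately show ?thesis
      using sub by (simp add: inf.absorb2)
  qed
  ultimately have "homeomorphic_map (subtopology N (f ` fst c)) (subtopology (topo M) (fst c)) g"
    by (rule homeomorphic_map_subtopologies)
  then have "homeomorphic_map (subtopology N (f ` fst c)) (top_of_set (chart_image c)) (snd c \<circ> g)"
    using chart unfolding is_chart_def by (blast intro: homeomorphic_map_compose)
  \<comment> \<open>The inverse \<open>g\<close> coming from the homeomorphism and the
    \<open>inv_into\<close> in the transported chart agree on the chart domain.\<close>
  then have "homeomorphic_map (subtopology N (f ` fst c)) (top_of_set (chart_image c))
      (snd (image_chart M f c))"
  proof (rule homeomorphic_map_eq)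
    fix p assume "p \<in> topspace (subtopology N (f ` fst c))"
    then obtain x where "x \<in> fst c" "p = f x"
      unfolding top by blast
    then show "(snd c \<circ> g) p = snd (image_chart M f c) p"
      using sub gf by (simp add: image_chart_apply subset_iff)
  qed
  then show ?thesis
    using open_N chart
    unfolding is_chart_def chart_image_image_chart[OF c] fst_image_chart N_def by blast
qed

text \<open>Transported charts have the transition maps of \<open>M\<close>, on the same open sets;
  the Hausdorff property and second countability are inherited from \<open>P\<close>.\<close>

lemma smooth_manifold_image_manifold: "smooth_manifold (image_manifold M P f)"
proof -
  have trans: "smooth_on (snd (image_chart M f c) ` (fst (image_chart M f c) \<inter> fst (image_chart M f d)))
      (snd (image_chart M f d) \<circ> chart_inv (image_chart M f c))"
    if c: "c \<in> atlas M" and d: "d \<in> atlas M" for c d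
  proof -
    let ?U = "snd c ` (fst c \<inter> fst d)"
    note sub = chart_domain_subset[OF M c] chart_domain_subset[OF M d]
    have "{x \<in> fst c. x \<in> fst d} = fst c \<inter> fst d"
      by blast
    then have op: "open ?U"
      using smooth_map_domain_open[OF M M smooth_map_identity[OF M] c d] by simp
    have "fst (image_chart M f c) \<inter> fst (image_chart M f d) = f ` (fst c \<inter> fst d)"
      unfolding fst_image_chart
      by (rule inj_on_image_Int[OF smooth_embedding_inj_on[OF f] sub, symmetric])
    then have U: "snd (image_chart M f c) ` (fst (image_chart M f c) \<inter> fst (image_chart M f d)) = ?U"
      using image_chart_image[of "fst c \<inter> fst d" c] sub by auto
    have eq: "(snd d \<circ> chart_inv c) y = (snd (image_chart M f d) \<circ> chart_inv (image_chart M f c)) y"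
      if "y \<in> ?U" for y
    proof -
      have y: "y \<in> chart_image c"
        using that by (auto simp: chart_image_def)
      show ?thesis
        using chart_inv_image_chart[OF c y] chart_inv_in[OF y] sub(1)
        by (simp add: image_chart_apply subset_iff)
    qed
    have "smooth_on ?U (snd d \<circ> chart_inv c)"
      using M c d unfolding smooth_manifold_def smoothly_compatible_def by blast
    then have "Ck_on k ?U (snd d \<circ> chart_inv c)" for k
      by (simp add: smooth_on_def)
    then have "Ck_on k ?U (snd (image_chart M f d) \<circ> chart_inv (image_chart M f c))" for k
      by (rule Ck_on_cong[OF _ op]) (rule eq)
    then show ?thesis
      unfolding U smooth_on_def by blast
  qed
  have compat: "smoothly_compatible (image_chart M f c) (image_chart M f d)"
    if "c \<in> atlas M" "d \<in> atlas M" for c d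
    unfolding smoothly_compatible_def
    using trans[OF that] trans[OF that(2,1)] by (simp only: Int_commute simp_thms)
  have "(\<Union>c\<in>atlas M. f ` fst c) = f ` points M"
    using M unfolding smooth_manifold_def by blast
  moreover have "Hausdorff_space (topo (image_manifold M P f))" "second_countable (topo (image_manifold M P f))"
    using P unfolding smooth_manifold_def topo_image_manifold
    by (auto intro: Hausdorff_space_subtopology second_countable_subtopology)
  ultimately show ?thesis
    unfolding smooth_manifold_def atlas_image_manifold
      points_image_manifold[OF smooth_embedding_smooth_map[OF f]]
    using is_chart_image_chart compat by (simp add: fst_image_chart)
qed

text \<open>Inclusion and \<open>f\<close> have the same coordinate expression, so both sides are
  the range of one map \<open>\<Phi>\<close>. This moves all statements about the image back to
  points of \<open>M\<close>.\<close>

lemma submanifold_tangent_space_image_manifold: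
  assumes x: "x \<in> points M"
  shows "submanifold_tangent_space (image_manifold M P f) P (f x) = tangent_map M P f x ` tangent_space M x"
proof -
  let ?N = "image_manifold M P f"
  note N = smooth_manifold_image_manifold and sm = smooth_embedding_smooth_map[OF f]
  have "f x \<in> points ?N"
    using x by (simp add: points_image_manifold[OF sm])
  then have k: "chart_at ?N (f x) \<in> charts_at ?N (f x)"
    by (rule chart_at_in[OF N])
  \<comment> \<open>\<open>tangent_map\<close> uses the chosen chart of the image manifold, so
    \<open>c\<close> is read off from that choice instead of being chosen in
    \<open>M\<close>.\<close>
  then obtain c where c: "c \<in> atlas M" "chart_at ?N (f x) = image_chart M f c" "f x \<in> f ` fst c"
    unfolding charts_at_def atlas_image_manifold by (auto simp: fst_image_chart)
  then have "x \<in> fst c"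
    using inj_on_image_mem_iff[OF smooth_embedding_inj_on[OF f] x chart_domain_subset[OF M c(1)]] by blast
  then have cx: "c \<in> charts_at M x"
    using c(1) by (simp add: charts_at_def)
  define \<Phi> where "\<Phi> u = (\<lambda>d. if d \<in> charts_at P (f x)
    then frechet_derivative (snd d \<circ> f \<circ> chart_inv c) (at (snd c x)) u else 0)" for u
  have "tangent_map M P f x v = \<Phi> (v c)" if "v \<in> tangent_space M x" for v
    unfolding \<Phi>_def using tangent_map_component[OF M P sm cx _ that]
    by (intro ext) (simp add: tangent_map_def)
  then have "tangent_map M P f x ` tangent_space M x = \<Phi> ` (\<lambda>v. v c) ` tangent_space M x"
    by (simp add: image_image)
  also have "(\<lambda>v. v c) ` tangent_space M x = UNIV"
    using tangent_vector_in_tangent_space[OF M cx] tangent_vector_component[OF M cx]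
    by (metis UNIV_eq_I image_eqI)
  finally have lhs: "tangent_map M P f x ` tangent_space M x = range \<Phi>" .
  have "frechet_derivative (snd d \<circ> (\<lambda>z. z) \<circ> chart_inv (image_chart M f c)) (at (snd (image_chart M f c) (f x)))
      = frechet_derivative (snd d \<circ> f \<circ> chart_inv c) (at (snd c x))" if d: "d \<in> charts_at P (f x)" for d
    unfolding image_chart_apply[OF x]
  proof (rule frechet_derivative_transform_open(2))
    show "(snd d \<circ> f \<circ> chart_inv c) differentiable at (snd c x)"
      by (rule smooth_map_differentiable[OF sm cx d])
    show "open (chart_image c)" "snd c x \<in> chart_image c"
      using charts_at_is_chart[OF M cx] \<open>x \<in> fst c\<close> by (auto simp: is_chart_def chart_image_def)
  qed (simp add: chart_inv_image_chart[OF c(1)])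
  then have "tangent_map ?N P (\<lambda>z. z) (f x) w = \<Phi> (w (image_chart M f c))" for w
    unfolding \<Phi>_def tangent_map_def Let_def c(2) by auto
  then have "submanifold_tangent_space ?N P (f x) = \<Phi> ` (\<lambda>w. w (image_chart M f c)) ` tangent_space ?N (f x)"
    by (simp add: submanifold_tangent_space_def image_image)
  also have "(\<lambda>w. w (image_chart M f c)) ` tangent_space ?N (f x) = UNIV"
    using tangent_vector_in_tangent_space[OF N k] tangent_vector_component[OF N k] unfolding c(2)
    by (metis UNIV_eq_I image_eqI)
  finally show ?thesis
    unfolding lhs .
qed

text \<open>Extending model vectors to tangent vectors turns injectivity on families into
  injectivity of the Jacobian, as the linear systems require.\<close>

lemma smooth_embedding_derivative_inj:
  assumes "c \<in> charts_at M x" "d \<in> charts_at P (f x)"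
  shows "inj (frechet_derivative (snd d \<circ> f \<circ> chart_inv c) (at (snd c x)))"
proof (rule injI)
  note sm = smooth_embedding_smooth_map[OF f] and x = charts_at_points[OF M assms(1)]
    and T = tangent_vector_in_tangent_space[OF M assms(1)] and T_c = tangent_vector_component[OF M assms(1)]
  fix u u'
  assume eq: "frechet_derivative (snd d \<circ> f \<circ> chart_inv c) (at (snd c x)) u
    = frechet_derivative (snd d \<circ> f \<circ> chart_inv c) (at (snd c x)) u'"
  have "tangent_map M P f x (tangent_vector M x c u) = tangent_map M P f x (tangent_vector M x c u')"
    by (rule tangent_space_eqI[OF tangent_map_in_tangent_space[OF M P sm x]
          tangent_map_in_tangent_space[OF M P sm x] assms(2)])
      (simp only: tangent_map_component[OF M P sm assms T] T_c eq)
  then have "tangent_vector M x c u = tangent_vector M x c u'"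
    using f x T unfolding smooth_embedding_def by (blast dest: inj_onD)
  then show "u = u'"
    by (metis T_c)
qed

lemma smooth_vector_field_embedding_lift:
  assumes Z: "smooth_vector_field P Z"
    and X: "\<And>x. x \<in> points M \<Longrightarrow> X x \<in> tangent_space M x"
    and XZ: "\<And>x. x \<in> points M \<Longrightarrow> tangent_map M P f x (X x) = Z (f x)"
  shows "smooth_vector_field M X"
  unfolding smooth_vector_field_def
proof (intro conjI ballI X)
  note sm = smooth_embedding_smooth_map[OF f]
  fix c assume c: "c \<in> atlas M"
  note chart = smooth_manifold_is_chart[OF M c]
  show "smooth_on (chart_image c) (\<lambda>y. X (chart_inv c y) c)"
    unfolding smooth_on_def
  proof (intro allI Ck_on_local)
    \<comment> \<open>A chart domain of \<open>M\<close> may be mapped across several charts of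
      \<open>P\<close>, so the system is set up only near \<open>y\<close>, in a chart
      \<open>d\<close> around the image point.\<close>
    fix k y assume y: "y \<in> chart_image c"
    define x where "x = chart_inv c y"
    have x: "x \<in> fst c" "snd c x = y"
      using chart_inv_in[OF y] chart_chart_inv[OF y] by (simp_all add: x_def)
    have "f x \<in> points P"
      using x(1) chart_domain_subset[OF M c] by (intro smooth_map_in_points[OF sm]) blast
    then have "chart_at P (f x) \<in> charts_at P (f x)"
      by (rule chart_at_in[OF P])
    then obtain d where d: "d \<in> atlas P" "f x \<in> fst d"
      unfolding charts_at_def by blast
    define U where "U = snd c ` {x \<in> fst c. f x \<in> fst d}"
    have U: "open U"
      unfolding U_def by (rule smooth_map_domain_open[OF M P sm c d(1)])
    have at_U: "c \<in> charts_at M (chart_inv c q)" "d \<in> charts_at P (f (chart_inv c q))"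
      "snd c (chart_inv c q) = q" if "q \<in> U" for q
      using that c d(1) chart_inv_chart[OF chart] by (auto simp: U_def charts_at_def)
    define F where "F = snd d \<circ> f \<circ> chart_inv c"
    have F: "Ck_on n U F" for n
      using sm c d(1) unfolding smooth_map_def smooth_on_def U_def F_def by blast
    have "Ck_on k U (\<lambda>q. X (chart_inv c q) c)"
    proof (rule Ck_on_linear_system_solution[OF U])
      show "linear (frechet_derivative F (at q))" if "q \<in> U" for q
        using Ck_on_has_derivative[OF F that] by (rule has_derivative_linear)
      show "inj (frechet_derivative F (at q))" if "q \<in> U" for q
        using smooth_embedding_derivative_inj[OF at_U(1,2)[OF that]] at_U(3)[OF that] by (simp add: F_def)
      show "Ck_on k U (\<lambda>q. frechet_derivative F (at q) u)" for u
        using F[of "Suc k"] by simp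
      \<comment> \<open>Written through \<open>F\<close>, the right-hand side is a composition with
        the chart expression of \<open>Z\<close>.\<close>
      have "Ck_on k U (\<lambda>q. Z (chart_inv d (F q)) d)"
      proof (rule Ck_on_compose[OF U F])
        show "Ck_on k (chart_image d) (\<lambda>q. Z (chart_inv d q) d)"
          using Z d(1) by (simp add: smooth_vector_field_def smooth_on_def)
        show "F ` U \<subseteq> chart_image d"
          using at_U(2) by (auto simp: F_def chart_image_def charts_at_def)
      qed
      then show "Ck_on k U (\<lambda>q. Z (f (chart_inv c q)) d)"
      proof (rule Ck_on_cong[OF _ U])
        show "Z (chart_inv d (F q)) d = Z (f (chart_inv c q)) d" if "q \<in> U" for q
          using chart_inv_chart[OF smooth_manifold_is_chart[OF P d(1)]] at_U(2)[OF that]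
          by (simp add: F_def charts_at_def)
      qed
      show "frechet_derivative F (at q) (X (chart_inv c q) c) = Z (f (chart_inv c q)) d" if "q \<in> U" for q
      proof -
        have q: "chart_inv c q \<in> points M"
          by (rule charts_at_points[OF M at_U(1)[OF that]])
        show ?thesis
          using tangent_map_component[OF M P sm at_U(1,2)[OF that] X[OF q]]
          by (simp add: XZ[OF q] at_U(3)[OF that] F_def)
      qed
    qed
    moreover have "y \<in> U"
      using x d(2) by (auto simp: U_def)
    ultimately show "\<exists>U. open U \<and> y \<in> U \<and> Ck_on k U (\<lambda>y. X (chart_inv c y) c)"
      using U by blast
  qed
qed

text \<open>The nontrivial inclusion in \<open>T\<^sup>\<circ>\<^sup>\<circ> = T\<close>. If the
  component of \<open>z\<close> were outside the range of the Jacobian, a separating vector would be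
  the constant component of a covector that kills \<open>T\<close> but not \<open>z\<close>.\<close>

lemma in_tangent_map_image_if_annihilated:
  assumes x: "x \<in> points M" and z: "z \<in> tangent_space P (f x)"
    and ann: "\<And>\<beta>. \<beta> \<in> annihilator P (f x) (tangent_map M P f x ` tangent_space M x) \<Longrightarrow> \<beta> z = 0"
  shows "z \<in> tangent_map M P f x ` tangent_space M x"
proof -
  note sm = smooth_embedding_smooth_map[OF f]
  define c where "c = chart_at M x"
  define d where "d = chart_at P (f x)"
  have c: "c \<in> charts_at M x"
    unfolding c_def by (rule chart_at_in[OF M x])
  have d: "d \<in> charts_at P (f x)"
    unfolding d_def by (rule chart_at_in[OF P smooth_map_in_points[OF sm x]])
  define L where "L = frechet_derivative (snd d \<circ> f \<circ> chart_inv c) (at (snd c x))"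
  have lin: "linear L"
    unfolding L_def using smooth_map_differentiable[OF sm c d] by (rule linear_frechet_derivative)
  have component: "tangent_map M P f x v d = L (v c)" if "v \<in> tangent_space M x" for v
    unfolding L_def by (rule tangent_map_component[OF M P sm c d that])
  note T = tangent_map_in_tangent_space[OF M P sm x]
  have "z d \<in> range L"
  proof (rule ccontr)
    assume "z d \<notin> range L"
    then obtain a where a: "\<And>u. a \<bullet> L u = 0" "a \<bullet> z d \<noteq> 0"
      using separate_from_range[OF lin] by blast
    have "chart_covector P d a (f x) \<in> annihilator P (f x) (tangent_map M P f x ` tangent_space M x)"
      using chart_covector_in_cotangent_space[OF P]
      by (auto simp: annihilator_def chart_covector_def component a(1))
    then show False
      using ann a(2) z by (fastforce simp: chart_covector_def)
  qed
  then obtain u where u: "z d = L u"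
    by blast
  note v = tangent_vector_in_tangent_space[OF M c, of u]
  have "z = tangent_map M P f x (tangent_vector M x c u)"
    by (rule tangent_space_eqI[OF z T d])
      (simp only: component[OF v] u tangent_vector_component[OF M c])
  then show ?thesis
    using v by blast
qed

end

section \<open>Hamiltonian vector fields and the slicing equation\<close>

text \<open>In a chart the \<open>b\<close>-component is minus the sum over \<open>a\<close> of the
  \<open>a\<close>-derivative of \<open>H\<close> times \<open>\<Lambda>\<close> on the constant
  covectors \<open>b\<close> and \<open>a\<close>, hence a finite sum of products of smooth
  functions.\<close>

lemma smooth_vector_field_hamiltonian:
  fixes P :: "('p, 'e::finite_dim_inner) manifold"
  assumes P: "smooth_manifold P" and ap: "almost_poisson P \<Lambda>" and H: "smooth_function P H"
  shows "smooth_vector_field P (hamiltonian_field P \<Lambda> H)"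
  unfolding smooth_vector_field_def
proof (intro conjI ballI)
  show Z: "hamiltonian_field P \<Lambda> H p \<in> tangent_space P p" if "p \<in> points P" for p
    unfolding hamiltonian_field_def
    by (rule sharp_in_tangent_space[OF P ap that differential_in_cotangent_space[OF P H that]])
  fix d assume d: "d \<in> atlas P"
  have op: "open (chart_image d)"
    using smooth_manifold_is_chart[OF P d] by (simp add: is_chart_def)
  have component: "(\<Sum>a\<in>onb. frechet_derivative (H \<circ> chart_inv d) (at y) a *\<^sub>R
        (- 1 * \<Lambda> (chart_inv d y) (chart_covector P d b (chart_inv d y)) (chart_covector P d a (chart_inv d y))))
      = hamiltonian_field P \<Lambda> H (chart_inv d y) d \<bullet> b"
    if y: "y \<in> chart_image d" for y b
  proof -
    define p where "p = chart_inv d y"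
    have dp: "d \<in> charts_at P p" "snd d p = y"
      using d chart_inv_in[OF y] chart_chart_inv[OF y] by (simp_all add: p_def charts_at_def)
    note p = charts_at_points[OF P dp(1)]
    note dH = differential_in_cotangent_space[OF P H p]
      and cb = chart_covector_in_cotangent_space[OF P, of d b p]
    have "hamiltonian_field P \<Lambda> H p d \<bullet> b = chart_covector P d b p (hamiltonian_field P \<Lambda> H p)"
      using Z[OF p] by (simp add: chart_covector_def inner_commute)
    also have "\<dots> = \<Lambda> p (differential P H p) (chart_covector P d b p)"
      unfolding hamiltonian_field_def by (rule covector_sharp[OF P ap p dH cb])
    \<comment> \<open>Skew-symmetry moves the differential to the second slot, where linearity in
      the components is at hand. It is then expanded, because smoothness of \<open>\<Lambda>\<close>
      is given on covectors with constant components.\<close>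
    also have "\<dots> = - \<Lambda> p (chart_covector P d b p) (differential P H p)"
      by (rule almost_poisson_skew[OF ap p dH cb])
    also have "\<Lambda> p (chart_covector P d b p) (differential P H p)
        = \<Lambda> p (chart_covector P d b p)
            (chart_covector P d (\<Sum>a\<in>onb. differential P H p (tangent_vector P p d a) *\<^sub>R a) p)"
      using covector_eq_chart_covector[OF P dp(1) dH] by (rule arg_cong)
    also have "\<dots> = (\<Sum>a\<in>onb. differential P H p (tangent_vector P p d a) *\<^sub>R
        \<Lambda> p (chart_covector P d b p) (chart_covector P d a p))"
      by (simp add: linear_sum[OF linear_almost_poisson_chart_covector[OF P ap p cb]]
          linear_scale[OF linear_almost_poisson_chart_covector[OF P ap p cb]])
    also have "\<dots> = (\<Sum>a\<in>onb. frechet_derivative (H \<circ> chart_inv d) (at y) a *\<^sub>R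
        \<Lambda> p (chart_covector P d b p) (chart_covector P d a p))"
      by (simp only: differential_component[OF P H dp(1) tangent_vector_in_tangent_space[OF P dp(1)]]
          tangent_vector_component[OF P dp(1)] dp(2))
    finally show ?thesis
      by (simp add: p_def sum_negf)
  qed
  show "smooth_on (chart_image d) (\<lambda>y. hamiltonian_field P \<Lambda> H (chart_inv d y) d)"
    unfolding smooth_on_def
  proof (rule allI, rule Ck_on_componentwise[OF op])
    fix k and b :: 'e
    have "Ck_on (Suc k) (chart_image d) (H \<circ> chart_inv d)"
      using H d unfolding smooth_function_def smooth_on_def by blast
    then have "Ck_on k (chart_image d) (\<lambda>y. frechet_derivative (H \<circ> chart_inv d) (at y) a)" for a
      by simp
    moreover have "Ck_on k (chart_image d) (\<lambda>y. \<Lambda> (chart_inv d y) (chart_covector P d b (chart_inv d y))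
        (chart_covector P d a (chart_inv d y)))" for a
      using ap d unfolding almost_poisson_def smooth_on_def by blast
    ultimately have "Ck_on k (chart_image d) (\<lambda>y. \<Sum>a\<in>onb. frechet_derivative (H \<circ> chart_inv d) (at y) a *\<^sub>R
        (- 1 * \<Lambda> (chart_inv d y) (chart_covector P d b (chart_inv d y)) (chart_covector P d a (chart_inv d y))))"
      by (intro Ck_on_sum[OF op] Ck_on_scaleR[OF op] Ck_on_linear[OF bounded_linear_mult_right op])
    then show "Ck_on k (chart_image d) (\<lambda>y. hamiltonian_field P \<Lambda> H (chart_inv d y) d \<bullet> b)"
      by (rule Ck_on_cong[OF _ op]) (rule component)
  qed
qed

lemma slicing_solution_iff_tangent:
  assumes P: "smooth_manifold P" and M: "smooth_manifold M" and f: "smooth_embedding M P f"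
    and Z: "smooth_vector_field P Z"
  shows "slicing_solution M P Z f \<longleftrightarrow>
    (\<forall>x\<in>points M. Z (f x) \<in> tangent_map M P f x ` tangent_space M x)"
proof
  assume "slicing_solution M P Z f"
  then obtain X where "smooth_vector_field M X" "\<forall>x\<in>points M. tangent_map M P f x (X x) = Z (f x)"
    unfolding slicing_solution_def by blast
  then show "\<forall>x\<in>points M. Z (f x) \<in> tangent_map M P f x ` tangent_space M x"
    unfolding smooth_vector_field_def by (metis imageI)
next
  assume "\<forall>x\<in>points M. Z (f x) \<in> tangent_map M P f x ` tangent_space M x"
  then have "\<forall>x\<in>points M. \<exists>v\<in>tangent_space M x. tangent_map M P f x v = Z (f x)"
    by (metis imageE)
  then obtain X where X: "\<And>x. x \<in> points M \<Longrightarrow> X x \<in> tangent_space M x"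
    "\<And>x. x \<in> points M \<Longrightarrow> tangent_map M P f x (X x) = Z (f x)"
    by metis
  then show "slicing_solution M P Z f"
    unfolding slicing_solution_def
    using smooth_vector_field_embedding_lift[OF M P f Z, of X] by blast
qed

section \<open>Annihilators, kernels and transposes at a point\<close>

lemma annihilatorD:
  "\<beta> \<in> annihilator P p F \<Longrightarrow> \<beta> \<in> cotangent_space P p"
  "\<beta> \<in> annihilator P p F \<Longrightarrow> v \<in> F \<Longrightarrow> \<beta> v = 0"
  by (simp_all add: annihilator_def)

lemma annihilator_sharp_annihilator_iff:
  assumes P: "smooth_manifold P" and ap: "almost_poisson P \<Lambda>" and M: "smooth_manifold M"
    and f: "smooth_embedding M P f" and x: "x \<in> points M" and \<beta>: "\<beta> \<in> cotangent_space P (f x)"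
  defines "T \<equiv> tangent_map M P f x ` tangent_space M x"
  shows "\<beta> \<in> annihilator P (f x) (sharp P \<Lambda> (f x) ` annihilator P (f x) T) \<longleftrightarrow> sharp P \<Lambda> (f x) \<beta> \<in> T"
proof -
  have p: "f x \<in> points P"
    using smooth_map_in_points[OF smooth_embedding_smooth_map[OF f] x] .
  have swap: "\<beta> (sharp P \<Lambda> (f x) \<gamma>) = - \<gamma> (sharp P \<Lambda> (f x) \<beta>)" if "\<gamma> \<in> annihilator P (f x) T" for \<gamma>
  proof -
    note \<gamma> = annihilatorD(1)[OF that]
    show ?thesis
      by (simp only: covector_sharp[OF P ap p \<gamma> \<beta>] covector_sharp[OF P ap p \<beta> \<gamma>]
          almost_poisson_skew[OF ap p \<gamma> \<beta>])
  qed
  have "\<beta> \<in> annihilator P (f x) (sharp P \<Lambda> (f x) ` annihilator P (f x) T)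
      \<longleftrightarrow> (\<forall>\<gamma>\<in>annihilator P (f x) T. \<beta> (sharp P \<Lambda> (f x) \<gamma>) = 0)"
    using \<beta> by (simp add: annihilator_def[of P "f x" "_ ` _"])
  also have "\<dots> \<longleftrightarrow> (\<forall>\<gamma>\<in>annihilator P (f x) T. \<gamma> (sharp P \<Lambda> (f x) \<beta>) = 0)"
    using swap by fastforce
  also have "\<dots> \<longleftrightarrow> sharp P \<Lambda> (f x) \<beta> \<in> T"
  proof
    assume "\<forall>\<gamma>\<in>annihilator P (f x) T. \<gamma> (sharp P \<Lambda> (f x) \<beta>) = 0"
    then show "sharp P \<Lambda> (f x) \<beta> \<in> T"
      unfolding T_def
      by (intro in_tangent_map_image_if_annihilated[OF M P f x sharp_in_tangent_space[OF P ap p \<beta>]]) blast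
  qed (simp add: annihilator_def)
  finally show ?thesis .
qed

lemma covector_sumI:
  assumes "\<gamma> \<in> A" "(\<lambda>v. \<beta> v - \<gamma> v) \<in> B"
  shows "\<beta> \<in> covector_sum A B"
  unfolding covector_sum_def
  using assms by (intro CollectI exI[of _ \<gamma>] exI[of _ "\<lambda>v. \<beta> v - \<gamma> v"]) simp

lemma covector_sum_sharp_kernel_iff:
  assumes P: "smooth_manifold P" and ap: "almost_poisson P \<Lambda>" and p: "p \<in> points P"
    and \<beta>: "\<beta> \<in> cotangent_space P p"
  shows "\<beta> \<in> covector_sum (annihilator P p T) (sharp_kernel P \<Lambda> p)
    \<longleftrightarrow> sharp P \<Lambda> p \<beta> \<in> sharp P \<Lambda> p ` annihilator P p T"
proof
  assume "\<beta> \<in> covector_sum (annihilator P p T) (sharp_kernel P \<Lambda> p)"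
  then obtain \<gamma> \<kappa> where \<gamma>: "\<beta> = (\<lambda>v. \<gamma> v + \<kappa> v)" "\<gamma> \<in> annihilator P p T" "\<kappa> \<in> sharp_kernel P \<Lambda> p"
    unfolding covector_sum_def by blast
  then have "(\<lambda>v. \<beta> v - \<gamma> v) \<in> sharp_kernel P \<Lambda> p"
    by simp
  then have "sharp P \<Lambda> p \<beta> = sharp P \<Lambda> p \<gamma>"
    using diff_in_sharp_kernel_iff[OF P ap p \<beta> annihilatorD(1)[OF \<gamma>(2)]] by simp
  then show "sharp P \<Lambda> p \<beta> \<in> sharp P \<Lambda> p ` annihilator P p T"
    using \<gamma>(2) by blast
next
  assume "sharp P \<Lambda> p \<beta> \<in> sharp P \<Lambda> p ` annihilator P p T"
  then obtain \<gamma> where \<gamma>: "sharp P \<Lambda> p \<beta> = sharp P \<Lambda> p \<gamma>" "\<gamma> \<in> annihilator P p T"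
    by blast
  then have "(\<lambda>v. \<beta> v - \<gamma> v) \<in> sharp_kernel P \<Lambda> p"
    using diff_in_sharp_kernel_iff[OF P ap p \<beta> annihilatorD(1)[OF \<gamma>(2)]] by simp
  with \<gamma>(2) show "\<beta> \<in> covector_sum (annihilator P p T) (sharp_kernel P \<Lambda> p)"
    by (rule covector_sumI)
qed

lemma cotangent_map_sharp_kernel_iff:
  fixes f :: "'m \<Rightarrow> 'p" and M :: "('m, 'd::finite_dim_inner) manifold"
    and P :: "('p, 'e::finite_dim_inner) manifold"
  assumes \<beta>: "\<beta> \<in> cotangent_space P (f x)"
  shows "cotangent_map M P f x \<beta> \<in> cotangent_map M P f x ` sharp_kernel P \<Lambda> (f x)
    \<longleftrightarrow> \<beta> \<in> covector_sum (annihilator P (f x) (tangent_map M P f x ` tangent_space M x))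
          (sharp_kernel P \<Lambda> (f x))"
proof -
  let ?A = "annihilator P (f x) (tangent_map M P f x ` tangent_space M x)"
  have diff: "cotangent_map M P f x \<beta> = cotangent_map M P f x \<kappa> \<longleftrightarrow> (\<lambda>v. \<beta> v - \<kappa> v) \<in> ?A"
    if "\<kappa> \<in> sharp_kernel P \<Lambda> (f x)" for \<kappa>
  proof -
    have "\<kappa> \<in> cotangent_space P (f x)"
      using that by (simp add: sharp_kernel_def)
    then have "(\<lambda>v. \<beta> v - \<kappa> v) \<in> cotangent_space P (f x)"
      using cotangent_space_linear_combination[OF \<beta>, of \<kappa> 1 "-1"] by simp
    then show ?thesis
      by (auto simp: annihilator_def cotangent_map_def fun_eq_iff)
  qed
  show ?thesis
  proof
    assume "cotangent_map M P f x \<beta> \<in> cotangent_map M P f x ` sharp_kernel P \<Lambda> (f x)"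
    then obtain \<kappa> where \<kappa>: "\<kappa> \<in> sharp_kernel P \<Lambda> (f x)" "(\<lambda>v. \<beta> v - \<kappa> v) \<in> ?A"
      using diff by blast
    \<comment> \<open>The summand in the annihilator is \<open>\<beta> - \<kappa>\<close>, so the
      remainder asked for by \<open>covector_sumI\<close> is \<open>\<kappa>\<close> again.\<close>
    show "\<beta> \<in> covector_sum ?A (sharp_kernel P \<Lambda> (f x))"
      by (rule covector_sumI[OF \<kappa>(2)]) (simp add: \<kappa>(1))
  next
    assume "\<beta> \<in> covector_sum ?A (sharp_kernel P \<Lambda> (f x))"
    then obtain \<gamma> \<kappa> where \<gamma>: "\<beta> = (\<lambda>v. \<gamma> v + \<kappa> v)" "\<gamma> \<in> ?A" "\<kappa> \<in> sharp_kernel P \<Lambda> (f x)"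
      unfolding covector_sum_def by blast
    then have "cotangent_map M P f x \<beta> = cotangent_map M P f x \<kappa>"
      using diff[OF \<gamma>(3)] by simp
    then show "cotangent_map M P f x \<beta> \<in> cotangent_map M P f x ` sharp_kernel P \<Lambda> (f x)"
      using \<gamma>(3) by blast
  qed
qed

theorem theorem5:
  fixes P :: "('p, 'e::finite_dim_inner) manifold"
    and \<Lambda> :: "('p, 'e) bivector_field"
    and H :: "'p \<Rightarrow> real"
    and Z :: "'p \<Rightarrow> ('p, 'e) tvec"
    and M :: "('m, 'd::finite_dim_inner) manifold"
    and \<alpha> :: "'m \<Rightarrow> 'p"
    and P0 :: "('p, 'd) manifold"
  assumes "smooth_manifold P" and "almost_poisson P \<Lambda>" and "smooth_function P H"
    and "Z = hamiltonian_field P \<Lambda> H"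
    and "smooth_manifold M" and "smooth_embedding M P \<alpha>"
    and "P0 = image_manifold M P \<alpha>"
  shows
    "(slicing_solution M P Z \<alpha> \<longleftrightarrow>
        (\<forall>x\<in>points M. differential P H (\<alpha> x) \<in>
           annihilator P (\<alpha> x)
             (sharp P \<Lambda> (\<alpha> x) `
                annihilator P (\<alpha> x) (submanifold_tangent_space P0 P (\<alpha> x))))) \<and>
     (lagrangian_submanifold P0 P \<Lambda> \<longrightarrow>
        (slicing_solution M P Z \<alpha> \<longleftrightarrow>
           (\<forall>x\<in>points M. differential P H (\<alpha> x) \<in>
              covector_sum (annihilator P (\<alpha> x) (submanifold_tangent_space P0 P (\<alpha> x)))
                           (sharp_kernel P \<Lambda> (\<alpha> x)))) \<and>
        (slicing_solution M P Z \<alpha> \<longleftrightarrow>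
           (\<forall>x\<in>points M. pullback_form M P \<alpha> (differential P H) x \<in>
              cotangent_map M P \<alpha> x ` sharp_kernel P \<Lambda> (\<alpha> x))))"
proof -
  note P = assms(1) and ap = assms(2) and H = assms(3) and M = assms(5) and \<alpha> = assms(6)
  note sm = smooth_embedding_smooth_map[OF \<alpha>]
  \<comment> \<open>Indexed by points of \<open>M\<close>: the slicing equation speaks of this image
    directly, and the next fact identifies it with the tangent space of \<open>P0\<close>.\<close>
  define T where "T x = tangent_map M P \<alpha> x ` tangent_space M x" for x
  have T: "submanifold_tangent_space P0 P (\<alpha> x) = T x" if "x \<in> points M" for x
    unfolding assms(7) T_def by (rule submanifold_tangent_space_image_manifold[OF M P \<alpha> that])
  have p: "\<alpha> x \<in> points P" if "x \<in> points M" for x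
    by (rule smooth_map_in_points[OF sm that])
  have dH: "differential P H (\<alpha> x) \<in> cotangent_space P (\<alpha> x)" if "x \<in> points M" for x
    by (rule differential_in_cotangent_space[OF P H p[OF that]])
  have "slicing_solution M P Z \<alpha> \<longleftrightarrow> (\<forall>x\<in>points M. Z (\<alpha> x) \<in> T x)"
    unfolding T_def assms(4)
    by (rule slicing_solution_iff_tangent[OF P M \<alpha> smooth_vector_field_hamiltonian[OF P ap H]])
  then have slicing: "slicing_solution M P Z \<alpha>
      \<longleftrightarrow> (\<forall>x\<in>points M. sharp P \<Lambda> (\<alpha> x) (differential P H (\<alpha> x)) \<in> T x)"
    unfolding assms(4) hamiltonian_field_def .
  have part1: "differential P H (\<alpha> x) \<in> annihilator P (\<alpha> x)
        (sharp P \<Lambda> (\<alpha> x) ` annihilator P (\<alpha> x) (submanifold_tangent_space P0 P (\<alpha> x)))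
      \<longleftrightarrow> sharp P \<Lambda> (\<alpha> x) (differential P H (\<alpha> x)) \<in> T x" if "x \<in> points M" for x
    unfolding T[OF that] T_def
    by (rule annihilator_sharp_annihilator_iff[OF P ap M \<alpha> that dH[OF that]])
  have part2: "differential P H (\<alpha> x) \<in> covector_sum
        (annihilator P (\<alpha> x) (submanifold_tangent_space P0 P (\<alpha> x))) (sharp_kernel P \<Lambda> (\<alpha> x))
      \<longleftrightarrow> sharp P \<Lambda> (\<alpha> x) (differential P H (\<alpha> x)) \<in> T x"
    if L: "lagrangian_submanifold P0 P \<Lambda>" and x: "x \<in> points M" for x
  proof -
    have "\<alpha> x \<in> points P0"
      using x unfolding assms(7) points_image_manifold[OF sm] by blast
    then have "sharp P \<Lambda> (\<alpha> x) ` annihilator P (\<alpha> x) (T x)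
        = T x \<inter> characteristic_distribution P \<Lambda> (\<alpha> x)"
      using L unfolding lagrangian_submanifold_def T[OF x, symmetric] by blast
    moreover have "sharp P \<Lambda> (\<alpha> x) (differential P H (\<alpha> x)) \<in> characteristic_distribution P \<Lambda> (\<alpha> x)"
      unfolding characteristic_distribution_def using dH[OF x] by (rule imageI)
    ultimately show ?thesis
      unfolding T[OF x] covector_sum_sharp_kernel_iff[OF P ap p[OF x] dH[OF x]] by simp
  qed
  have part3: "pullback_form M P \<alpha> (differential P H) x \<in> cotangent_map M P \<alpha> x ` sharp_kernel P \<Lambda> (\<alpha> x)
      \<longleftrightarrow> differential P H (\<alpha> x) \<in> covector_sum
        (annihilator P (\<alpha> x) (submanifold_tangent_space P0 P (\<alpha> x))) (sharp_kernel P \<Lambda> (\<alpha> x))"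
    if "x \<in> points M" for x
    unfolding pullback_form_def T[OF that] T_def
    by (rule cotangent_map_sharp_kernel_iff[where f = \<alpha>, OF dH[OF that]])
  show ?thesis
    using slicing part1 part2 part3 by (intro conjI impI) simp_all
qed

end
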